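(* For all nonnegative integers $n,n_1,n_2,n_3,n_4$, $$\widetilde f_n(n_1,n_2,n_3,n_4;q) = \sum_{\sigma\in \mathcal{CM}(n;n_1,n_2,n_3,n_4)} q^{\operatorname{cr}(\sigma)}.$$
   Context: Let $0<q<1$ and $(x)_\infty=\prod_{i\ge0}(1-xq^i)$. The continuous $q$-Hermite polynomials $H_n(x|q)$ are defined by $H_{-1}=0$, $H_0=1$, $H_{n+1}(x|q)=2xH_n(x|q)-(1-q^n)H_{n-1}(x|q)$, and $v(\cos\theta|q)=(e^{2i\theta})_\infty(e^{-2i\theta})_\infty$. The rescaled $q$-Hermite polynomials are $$\widetilde H_n(x|q)=\frac{H_n\left(\frac{\sqrt{1-q}}2x\,\big|\,q\right)}{(1-q)^{n/2}},$$ and $$\widetilde v(x|q)=\frac{v\left(\frac{\sqrt{1-q}}2x\,\big|\,q\right)\cdot\frac{\sqrt{1-q}}2}{\sqrt{1-(1-q)x^2/4}}.$$ Define $$\widetilde f_n(n_1,n_2,n_3,n_4;q)=\frac{(q)_\infty}{2\pi}\int_{-2/\sqrt{1-q}}^{2/\sqrt{1-q}}x^n\,\widetilde H_{n_1}(x|q)\widetilde H_{n_2}(x|q)\widetilde H_{n_3}(x|q)\widetilde H_{n_4}(x|q)\,\widetilde v(x|q)\,dx.$$ A complete matching on a finite set of integers is a partition of the set into blocks (edges) of size 2. The crossing number $\operatorname{cr}(\sigma)$ of a complete matching $\sigma$ is the number of pairs of edges $\{i_1,j_1\},\{i_2,j_2\}$ of $\sigma$ with $i_1<i_2<j_1<j_2$.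 Let $S_0=\{1,\dots,n\}$ and, for $i=1,2,3,4$, $S_i=\{m_{i-1}+1,\dots,m_i\}$, where $m_0=n$ and $m_i=n+n_1+\cdots+n_i$. Then $\mathcal{CM}(n;n_1,n_2,n_3,n_4)$ is the set of complete matchings on $S_0\cup S_1\cup S_2\cup S_3\cup S_4$ such that no edge is contained in $S_i$ for $i=1,2,3,4$ (edges contained in $S_0$ are allowed). *)

theory Defs
  imports "HOL-Analysis.Analysis" "HOL-Library.Disjoint_Sets"
begin

definition qpoch_inf :: "'a::real_normed_field \<Rightarrow> 'a \<Rightarrow> 'a" where
  "qpoch_inf x q = (\<Prod>i. 1 - x * q ^ i)"

text \<open>The second equation is the recurrence at index \<open>0\<close> with the convention \<open>H\<^sub>-\<^sub>1 = 0\<close>.\<close>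

fun qHermite :: "real \<Rightarrow> nat \<Rightarrow> real \<Rightarrow> real" where
  "qHermite q 0 x = 1"
| "qHermite q (Suc 0) x = 2 * x"
| "qHermite q (Suc (Suc n)) x =
     2 * x * qHermite q (Suc n) x - (1 - q ^ Suc n) * qHermite q n x"

text \<open>The weight is specified only at points \<open>x = cos \<theta>\<close>, that is, for \<open>x \<in> [-1, 1]\<close>.
  The two factors are complex conjugates, so their product is real and taking the real part
  loses nothing; lemma \<open>qHermite_weight_cos\<close> below confirms this, for every angle \<open>\<theta>\<close>.\<close>

definition qHermite_weight :: "real \<Rightarrow> real \<Rightarrow> real" where
  "qHermite_weight q x =
     (let \<theta> = arccos x in
      Re (qpoch_inf (exp (2 * \<i> * complex_of_real \<theta>)) (complex_of_real q) *
          qpoch_inf (exp (- 2 * \<i> * complex_of_real \<theta>)) (complex_of_real q)))"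

lemma qpoch_inf_cnj:
  fixes q :: real
  assumes "\<bar>q\<bar> < 1"
  shows "qpoch_inf (cnj z) (complex_of_real q) = cnj (qpoch_inf z (complex_of_real q))"
proof -
  have conv: "convergent_prod (\<lambda>i. 1 - w * complex_of_real q ^ i)" for w
  proof -
    have "summable (\<lambda>i. norm ((1 - w * complex_of_real q ^ i) - 1))"
      using assms by (simp add: norm_mult norm_power summable_mult summable_geometric)
    thus ?thesis
      by (intro abs_convergent_prod_imp_convergent_prod summable_imp_abs_convergent_prod)
  qed
  have "(\<lambda>n. cnj (\<Prod>i\<le>n. 1 - z * complex_of_real q ^ i))
          \<longlonglongrightarrow> cnj (qpoch_inf z (complex_of_real q))"
    unfolding qpoch_inf_def by (intro tendsto_cnj convergent_prod_LIMSEQ conv)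
  moreover have "(\<lambda>n. \<Prod>i\<le>n. 1 - cnj z * complex_of_real q ^ i)
          \<longlonglongrightarrow> qpoch_inf (cnj z) (complex_of_real q)"
    unfolding qpoch_inf_def by (intro convergent_prod_LIMSEQ conv)
  ultimately show ?thesis
    by (simp add: LIMSEQ_unique)
qed

lemma qHermite_weight_cos:
  fixes q \<theta> :: real
  assumes "\<bar>q\<bar> < 1"
  shows "complex_of_real (qHermite_weight q (cos \<theta>)) =
    qpoch_inf (exp (2 * \<i> * complex_of_real \<theta>)) (complex_of_real q) *
    qpoch_inf (exp (- 2 * \<i> * complex_of_real \<theta>)) (complex_of_real q)"
proof -
  let ?P = "\<lambda>z. qpoch_inf z (complex_of_real q)"
  define t where "t = arccos (cos \<theta>)"
  have e: "exp (2 * \<i> * complex_of_real s) = (cis s)\<^sup>2"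
          "exp (- 2 * \<i> * complex_of_real s) = (cnj (cis s))\<^sup>2" for s
    by (simp_all add: cis_conv_exp exp_double[symmetric] exp_cnj mult_ac)
  have ct: "cos t = cos \<theta>" unfolding t_def by simp
  have "(sin t)\<^sup>2 = (sin \<theta>)\<^sup>2" by (simp add: sin_squared_eq ct)
  hence "cis t = cis \<theta> \<or> cis t = cnj (cis \<theta>)"
    using ct by (auto simp: power2_eq_iff complex_eq_iff)
  hence "?P ((cis t)\<^sup>2) * ?P ((cnj (cis t))\<^sup>2) = ?P ((cis \<theta>)\<^sup>2) * ?P ((cnj (cis \<theta>))\<^sup>2)"
    by (auto simp: mult.commute)
  moreover have "?P ((cis \<theta>)\<^sup>2) * ?P ((cnj (cis \<theta>))\<^sup>2) \<in> \<real>"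
    by (metis qpoch_inf_cnj[OF assms] complex_cnj_power complex_mult_cnj Reals_of_real)
  ultimately show ?thesis
    unfolding qHermite_weight_def Let_def t_def[symmetric] e by (metis of_real_Re)
qed

definition qHermite_resc :: "real \<Rightarrow> nat \<Rightarrow> real \<Rightarrow> real" where
  "qHermite_resc q n x = qHermite q n (sqrt (1 - q) / 2 * x) / (1 - q) powr (real n / 2)"

definition qHermite_weight_resc :: "real \<Rightarrow> real \<Rightarrow> real" where
  "qHermite_weight_resc q x =
     qHermite_weight q (sqrt (1 - q) / 2 * x) * (sqrt (1 - q) / 2) / sqrt (1 - (1 - q) * x\<^sup>2 / 4)"

definition f_resc :: "nat \<Rightarrow> nat \<Rightarrow> nat \<Rightarrow> nat \<Rightarrow> nat \<Rightarrow> real \<Rightarrow> real" where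
  "f_resc n n1 n2 n3 n4 q =
     qpoch_inf q q / (2 * pi) *
     integral {- 2 / sqrt (1 - q) .. 2 / sqrt (1 - q)}
       (\<lambda>x. x ^ n * qHermite_resc q n1 x * qHermite_resc q n2 x *
            qHermite_resc q n3 x * qHermite_resc q n4 x * qHermite_weight_resc q x)"

definition complete_matching :: "nat set \<Rightarrow> nat set set \<Rightarrow> bool" where
  "complete_matching A \<sigma> \<longleftrightarrow> partition_on A \<sigma> \<and> (\<forall>e\<in>\<sigma>. card e = 2)"

text \<open>The strict inequalities determine which edge of a crossing pair comes first, so counting
  ordered pairs of edges counts each crossing exactly once.\<close>

definition crossing_number :: "nat set set \<Rightarrow> nat" where
  "crossing_number \<sigma> =
     card {(e1, e2). e1 \<in> \<sigma> \<and> e2 \<in> \<sigma> \<and>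
       (\<exists>i1 j1 i2 j2. e1 = {i1, j1} \<and> e2 = {i2, j2} \<and> i1 < i2 \<and> i2 < j1 \<and> j1 < j2)}"

text \<open>For \<open>ns = [n\<^sub>1, n\<^sub>2, \<dots>]\<close>, \<open>seg_end n ns i\<close> is \<open>m\<^sub>i = n + n\<^sub>1 + \<dots> + n\<^sub>i\<close> and
  \<open>segment n ns i\<close> is \<open>S\<^sub>i\<close>.\<close>

definition seg_end :: "nat \<Rightarrow> nat list \<Rightarrow> nat \<Rightarrow> nat" where
  "seg_end n ns i = n + sum_list (take i ns)"

definition segment :: "nat \<Rightarrow> nat list \<Rightarrow> nat \<Rightarrow> nat set" where
  "segment n ns i =
     (if i = 0 then {1..n} else {seg_end n ns (i - 1) + 1 .. seg_end n ns i})"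

definition CM :: "nat \<Rightarrow> nat list \<Rightarrow> nat set set set" where
  "CM n ns =
     {\<sigma>. complete_matching (\<Union>i\<in>{0..length ns}. segment n ns i) \<sigma> \<and>
          (\<forall>i\<in>{1..length ns}. \<forall>e\<in>\<sigma>. \<not> e \<subseteq> segment n ns i)}"

end

theory Submission
  imports Defs
begin

text \<open>
  Let \<open>L\<close> be the functional \<open>p \<mapsto> (q)\<^sub>\<infinity> / 2\<pi> \<integral> p v\<close> of the rescaled weight \<open>v\<close>. Replacing the weight by
  the finite products over \<open>i < N\<close>, the trigonometric moments of the \<open>H\<^sub>n\<close> have a closed product
  form, proved by induction on \<open>N\<close>; letting \<open>N \<rightarrow> \<infinity>\<close> by dominated convergence gives
  \<open>L H\<^sub>n = 0\<close> for \<open>n > 0\<close> and \<open>L 1 = 1\<close>.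

  Points of \<open>S\<^sub>0\<close> are blocks of size 1, with \<open>H\<^sub>1 = x\<close>. Splitting the first point \<open>p\<close> off a block of size
  \<open>a + 1\<close> adds the matchings that join \<open>p\<close> to the \<open>j\<close>-th later point of the block. All points between
  are joined to the outside of the block, so that edge has \<open>j - 1\<close> crossings, and the added
  matchings contribute \<open>[a]\<^sub>q\<close> times the sum for block size \<open>a - 1\<close>. This mirrors
  \<open>H\<^sub>1 H\<^sub>a = H\<^sub>a\<^sub>+\<^sub>1 + [a]\<^sub>q H\<^sub>a\<^sub>-\<^sub>1\<close>. By induction on the number of points, the difference of the two sides
  of the theorem is invariant under splitting; hence it is the same for all block structures, and
  for a single block both sides vanish.
\<close>

section \<open>Gaussian binomials and trigonometric moments\<close>

fun gauss_binomial :: "real \<Rightarrow> nat \<Rightarrow> nat \<Rightarrow> real" where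
  "gauss_binomial q n 0 = 1"
| "gauss_binomial q 0 (Suc k) = 0"
| "gauss_binomial q (Suc n) (Suc k) = gauss_binomial q n k + q ^ Suc k * gauss_binomial q n (Suc k)"

definition qpoch_fin :: "real \<Rightarrow> nat \<Rightarrow> real" where
  "qpoch_fin q n = (\<Prod>i<n. 1 - q ^ Suc i)"

lemma qpoch_fin_0 [simp]: "qpoch_fin q 0 = 1"
  by (simp add: qpoch_fin_def)

lemma qpoch_fin_Suc: "qpoch_fin q (Suc n) = (1 - q ^ Suc n) * qpoch_fin q n"
  by (simp add: qpoch_fin_def)

lemma qpoch_fin_pos:
  assumes "0 < q" "q < 1"
  shows "qpoch_fin q n > 0"
  unfolding qpoch_fin_def using power_Suc_less_one[OF assms] by (intro prod_pos) simp

lemma gauss_binomial_eq_0: "n < k \<Longrightarrow> gauss_binomial q n k = 0"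
  by (induction q n k rule: gauss_binomial.induct) auto

text \<open>The absorption rule for Gaussian binomials, kept free of division so that it holds for
  every real \<open>q\<close>. The Pascal rule and the induction hypothesis leave a multiple of
  \<open>?G n k\<close>; a second use of both turns it into a multiple of
  \<open>?G (Suc n) k\<close>.\<close>

lemma gauss_binomial_absorb:
  "(1 - q ^ Suc k) * gauss_binomial q (Suc n) (Suc k) = (1 - q ^ Suc n) * gauss_binomial q n k"
proof (induction n arbitrary: k)
  case 0
  show ?case by (cases k) auto
next
  case (Suc n)
  let ?G = "gauss_binomial q"
  have eq: "(1 - q ^ Suc k) * ?G (Suc (Suc n)) (Suc k)
      = (1 - q ^ Suc k) * ?G (Suc n) k + q ^ Suc k * ((1 - q ^ Suc n) * ?G n k)"
    unfolding Suc.IH[symmetric] gauss_binomial.simps(3)[of q "Suc n"] by (simp add: algebra_simps)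
  show ?case
  proof (cases k)
    case 0
    then show ?thesis using eq by (simp add: algebra_simps)
  next
    case (Suc j)
    have "q ^ Suc k * ((1 - q ^ Suc n) * ?G n k)
        = q * (1 - q ^ Suc n) * (?G (Suc n) k - ?G n j)"
      by (simp add: Suc)
    also have "\<dots> = q * (1 - q ^ Suc n) * ?G (Suc n) k - q * ((1 - q ^ k) * ?G (Suc n) k)"
      unfolding Suc Suc.IH by (simp only: algebra_simps)
    finally show ?thesis unfolding eq by (simp add: algebra_simps)
  qed
qed

text \<open>The closed form (q)_{n+k} / ((q)_k (q)_n), obtained by iterating absorption in
  \<open>k\<close>.\<close>

lemma gauss_binomial_qpoch_fin:
  "gauss_binomial q (n + k) k * qpoch_fin q k * qpoch_fin q n = qpoch_fin q (n + k)"
proof (induction k)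
  case (Suc k)
  have "gauss_binomial q (n + Suc k) (Suc k) * qpoch_fin q (Suc k) * qpoch_fin q n
      = ((1 - q ^ Suc k) * gauss_binomial q (Suc (n + k)) (Suc k)) * qpoch_fin q k * qpoch_fin q n"
    by (simp only: qpoch_fin_Suc add_Suc_right mult_ac)
  also have "\<dots> = (1 - q ^ Suc (n + k)) * qpoch_fin q (n + k)"
    unfolding gauss_binomial_absorb Suc.IH[symmetric] by (simp only: mult_ac)
  finally show ?case by (simp only: qpoch_fin_Suc add_Suc_right)
qed simp

text \<open>Multiplication by \<open>2 * cos t\<close> moves each frequency up and down by one. At
  equal frequency, the Pascal rule and absorption show that the resulting coefficients exceed the
  new ones exactly by the contribution of
  \<open>(1 - q ^ Suc n) * qHermite q n (cos t)\<close>.\<close>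

lemma qHermite_cos:
  "qHermite q n (cos t) = (\<Sum>k\<le>n. gauss_binomial q n k * cos ((real n - 2 * real k) * t))"
proof (induction q n "cos t" rule: qHermite.induct)
  case (2 q)
  show ?case by simp
next
  case (3 q n)
  let ?G = "gauss_binomial q"
  let ?c = "\<lambda>k. cos ((real n - 2 * real k) * t)"
  \<comment> \<open>Peeling off \<open>k = 0\<close> lines the remaining frequencies up with those
    of \<open>?c\<close>.\<close>
  have shift: "(\<Sum>k\<le>Suc (Suc n). a k * cos ((real (Suc (Suc n)) - 2 * real k) * t))
      = a 0 * cos (real (Suc (Suc n)) * t) + (\<Sum>k\<le>Suc n. a (Suc k) * ?c k)" for a
    by (subst sum.atMost_Suc_shift) (simp add: algebra_simps)
  have "2 * cos t * qHermite q (Suc n) (cos t)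
      = (\<Sum>k\<le>Suc n. ?G (Suc n) k * (2 * cos t * cos ((real (Suc n) - 2 * real k) * t)))"
    unfolding 3(1) by (simp only: sum_distrib_left mult_ac)
  also have "\<dots> = (\<Sum>k\<le>Suc n. ?G (Suc n) k * cos ((real (Suc (Suc n)) - 2 * real k) * t)
                     + ?G (Suc n) k * ?c k)"
  proof (intro sum.cong refl)
    fix k
    have "2 * cos t * cos ((real (Suc n) - 2 * real k) * t)
        = cos ((real (Suc (Suc n)) - 2 * real k) * t) + ?c k"
      using cos_times_cos[of t "(real (Suc n) - 2 * real k) * t"]
        cos_minus[of "t - (real (Suc n) - 2 * real k) * t"]
      by (simp add: algebra_simps)
    then show "?G (Suc n) k * (2 * cos t * cos ((real (Suc n) - 2 * real k) * t))
        = ?G (Suc n) k * cos ((real (Suc (Suc n)) - 2 * real k) * t) + ?G (Suc n) k * ?c k"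
      by (simp add: algebra_simps)
  qed
  also have "\<dots> = (\<Sum>k\<le>Suc (Suc n). ?G (Suc n) k * cos ((real (Suc (Suc n)) - 2 * real k) * t))
                   + (\<Sum>k\<le>Suc n. ?G (Suc n) k * ?c k)"
    by (simp add: sum.distrib gauss_binomial_eq_0)
  also have "\<dots> = cos (real (Suc (Suc n)) * t)
                   + (\<Sum>k\<le>Suc n. (?G (Suc n) (Suc k) + ?G (Suc n) k) * ?c k)"
    by (subst shift) (simp add: sum.distrib algebra_simps)
  also have "(\<Sum>k\<le>Suc n. (?G (Suc n) (Suc k) + ?G (Suc n) k) * ?c k)
      = (\<Sum>k\<le>Suc n. ?G (Suc (Suc n)) (Suc k) * ?c k) + (1 - q ^ Suc n) * (\<Sum>k\<le>Suc n. ?G n k * ?c k)"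
  proof -
    have "?G (Suc n) (Suc k) + ?G (Suc n) k
        = ?G (Suc (Suc n)) (Suc k) + (1 - q ^ Suc n) * ?G n k" for k
      using gauss_binomial_absorb[of q k n] gauss_binomial.simps(3)[of q "Suc n" k]
      by (simp only:) (simp add: algebra_simps)
    then show ?thesis
      by (simp only: sum_distrib_left sum.distrib[symmetric] distrib_right mult.assoc)
  qed
  also have "(\<Sum>k\<le>Suc n. ?G n k * ?c k) = qHermite q n (cos t)"
    unfolding 3(2) by (simp add: gauss_binomial_eq_0)
  finally show ?case using shift[of "?G (Suc (Suc n))"] by simp
qed simp

lemma has_integral_cos_0_pi:
  "((\<lambda>t. cos (of_int a * t)) has_integral (if a = 0 then pi else 0)) {0..pi}"
proof (cases "a = 0")
  case True
  then show ?thesis using has_integral_const_real[of "1::real" 0 pi] by simp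
next
  case False
  have "((\<lambda>t. cos (of_int a * t)) has_integral
      (sin (of_int a * pi) / of_int a - sin (of_int a * 0) / of_int a)) {0..pi}"
    by (rule fundamental_theorem_of_calculus)
      (use False in \<open>auto intro!: derivative_eq_intros simp flip: has_real_derivative_iff_has_vector_derivative\<close>)
  then show ?thesis using False by (simp add: sin_int_times_real mult.commute)
qed

text \<open>Only a term of zero frequency survives in \<open>qHermite_cos\<close>, which requires
  \<open>n = 2 * k\<close>.\<close>

lemma has_integral_qHermite_cos:
  "((\<lambda>t. qHermite q n (cos t)) has_integral
     (if even n then pi * gauss_binomial q n (n div 2) else 0)) {0..pi}"
proof -
  have "((\<lambda>t. \<Sum>k\<le>n. gauss_binomial q n k * cos ((real n - 2 * real k) * t)) has_integral
     (\<Sum>k\<le>n. gauss_binomial q n k * (if int n - 2 * int k = 0 then pi else 0))) {0..pi}"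
    using has_integral_cos_0_pi[of "int n - 2 * int _"]
    by (intro has_integral_sum has_integral_mult_right) simp_all
  also have "(\<Sum>k\<le>n. gauss_binomial q n k * (if int n - 2 * int k = 0 then pi else 0))
      = (if even n then pi * gauss_binomial q n (n div 2) else 0)"
  proof (cases "even n")
    case True
    have "(\<Sum>k\<le>n. gauss_binomial q n k * (if int n - 2 * int k = 0 then pi else 0))
        = (\<Sum>k\<le>n. if k = n div 2 then gauss_binomial q n k * pi else 0)"
      using True by (intro sum.cong) auto
    then show ?thesis using True by simp
  next
    case False
    then have "int n - 2 * int k \<noteq> 0" for k by presburger
    then show ?thesis using False by simp
  qed
  finally show ?thesis by (simp only: qHermite_cos)
qed

text \<open>Two uses of the three-term recurrence resolve the product with \<open>y\<^sup>2\<close>.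
  The truncated subtractions are harmless: \<open>1 - q ^ n\<close> vanishes at \<open>n = 0\<close>
  and \<open>1 - q ^ (n - 1)\<close> at \<open>n = 1\<close>.\<close>

lemma qHermite_times_weight_factor:
  "qHermite q n y * ((1 + T)\<^sup>2 - 4 * T * y\<^sup>2) =
     (1 + T\<^sup>2 + T * q ^ n + T * q ^ Suc n) * qHermite q n y - T * qHermite q (Suc (Suc n)) y
     - T * (1 - q ^ n) * (1 - q ^ (n - 1)) * qHermite q (n - 2) y"
proof (cases n)
  case 0
  then show ?thesis by (simp add: algebra_simps power2_eq_square)
next
  case n: (Suc k)
  show ?thesis
  proof (cases k)
    case 0
    then show ?thesis using n by (simp add: algebra_simps power2_eq_square numeral_eq_Suc)
  next
    case (Suc j)
    have "2 * y * qHermite q k y = qHermite q n y + (1 - q ^ k) * qHermite q j y"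
      by (simp add: n Suc)
    moreover have "2 * y * (2 * y * a - b * c) = 4 * y\<^sup>2 * a - b * (2 * y * c)" for a b c
      by (simp add: algebra_simps power2_eq_square)
    ultimately have "2 * y * (2 * y * qHermite q n y - (1 - q ^ n) * qHermite q k y)
        = 4 * y\<^sup>2 * qHermite q n y - (1 - q ^ n) * (qHermite q n y + (1 - q ^ k) * qHermite q j y)"
      by (simp only:)
    moreover have "qHermite q (Suc (Suc n)) y
        = 2 * y * (2 * y * qHermite q n y - (1 - q ^ n) * qHermite q k y)
          - (1 - q ^ Suc n) * qHermite q n y"
      by (simp add: n)
    moreover have "n - 1 = k" "n - 2 = j" by (simp_all add: n Suc)
    ultimately show ?thesis
      by (simp only:) (simp add: algebra_simps power2_eq_square del: qHermite.simps)
  qed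
qed

section \<open>The truncated weight\<close>

text \<open>At \<open>y = cos t\<close> the factor \<open>i\<close> is (1 - q^i e^{2it}) (1 - q^i
  e^{-2it}), so these are the partial products of the weight, written as polynomials in
  \<open>y\<close>.\<close>

definition weight_fin :: "real \<Rightarrow> nat \<Rightarrow> real \<Rightarrow> real" where
  "weight_fin q N y = (\<Prod>i<N. (1 + q ^ i)\<^sup>2 - 4 * q ^ i * y\<^sup>2)"

lemma convergent_prod_qpoch:
  fixes z q :: "'a::{real_normed_field,banach,heine_borel}"
  assumes "norm q < 1"
  shows "convergent_prod (\<lambda>i. 1 - z * q ^ i)"
proof -
  have "summable (\<lambda>i. norm ((1 - z * q ^ i) - 1))"
    using assms by (simp add: norm_mult norm_power summable_mult summable_geometric)
  then show ?thesis
    by (intro abs_convergent_prod_imp_convergent_prod summable_imp_abs_convergent_prod)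
qed

lemma qpoch_inf_LIMSEQ:
  fixes z q :: "'a::{real_normed_field,banach,heine_borel}"
  assumes "norm q < 1"
  shows "(\<lambda>N. \<Prod>i<N. 1 - z * q ^ i) \<longlonglongrightarrow> qpoch_inf z q"
  using convergent_prod_LIMSEQ[OF convergent_prod_qpoch[OF assms]]
  by (simp add: qpoch_inf_def LIMSEQ_lessThan_iff_atMost)

lemma qpoch_fin_LIMSEQ:
  assumes "0 < q" "q < 1"
  shows "qpoch_fin q \<longlonglongrightarrow> qpoch_inf q q"
  using qpoch_inf_LIMSEQ[of q q] assms by (simp add: qpoch_fin_def[abs_def])

lemma qpoch_inf_self_nonzero:
  fixes q :: real
  assumes "0 < q" "q < 1"
  shows "qpoch_inf q q \<noteq> 0"
  unfolding qpoch_inf_def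
proof (rule prodinf_nonzero)
  show "convergent_prod (\<lambda>i. 1 - q * q ^ i)"
    using assms by (intro convergent_prod_qpoch) simp
  show "1 - q * q ^ i \<noteq> 0" for i
    using power_Suc_less_one[OF assms, of i] by simp
qed

lemma weight_fin_LIMSEQ:
  assumes "0 < q" "q < 1"
  shows "(\<lambda>N. weight_fin q N (cos t)) \<longlonglongrightarrow> qHermite_weight q (cos t)"
proof -
  define u where "u = exp (2 * \<i> * complex_of_real t)"
  have cnj_u: "exp (- 2 * \<i> * complex_of_real t) = cnj u"
    by (simp add: u_def exp_cnj)
  have u: "u = cis (2 * t)"
    by (simp add: u_def cis_conv_exp mult_ac)
  have re_u: "Re u = 2 * (cos t)\<^sup>2 - 1"
    using cos_double_cos[of t] by (simp add: u)
  have factor: "(1 - u * a) * (1 - cnj u * a) = complex_of_real ((1 + x)\<^sup>2 - 4 * x * (cos t)\<^sup>2)"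
    if "a = complex_of_real x" for a x
  proof -
    have "(1 - u * a) * (1 - cnj u * a) = 1 - a * (u + cnj u) + a\<^sup>2 * (u * cnj u)"
      by (simp add: algebra_simps power2_eq_square)
    also have "u * cnj u = 1"
      by (simp add: u cis_cnj cis_mult)
    also have "u + cnj u = complex_of_real (2 * (2 * (cos t)\<^sup>2 - 1))"
      by (simp only: complex_add_cnj re_u)
    finally show ?thesis
      by (simp add: that algebra_simps power2_eq_square)
  qed
  have "(\<lambda>N. (\<Prod>i<N. 1 - u * complex_of_real q ^ i) * (\<Prod>i<N. 1 - cnj u * complex_of_real q ^ i))
      \<longlonglongrightarrow> qpoch_inf u (complex_of_real q) * qpoch_inf (cnj u) (complex_of_real q)"
    using assms by (intro tendsto_mult qpoch_inf_LIMSEQ) auto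
  also have "(\<lambda>N. (\<Prod>i<N. 1 - u * complex_of_real q ^ i) * (\<Prod>i<N. 1 - cnj u * complex_of_real q ^ i))
      = (\<lambda>N. complex_of_real (weight_fin q N (cos t)))"
    unfolding weight_fin_def of_real_prod
    by (intro ext) (simp only: prod.distrib[symmetric] factor[OF of_real_power[symmetric]])
  also have "qpoch_inf u (complex_of_real q) * qpoch_inf (cnj u) (complex_of_real q)
      = complex_of_real (qHermite_weight q (cos t))"
    using qHermite_weight_cos[of q t] assms unfolding cnj_u u_def[symmetric] by simp
  finally show ?thesis
    by (simp only: tendsto_of_real_iff)
qed

text \<open>In the notation of the Rogers polynomials \<open>C\<^sub>n(x; \<beta> | q)\<close>: the truncated weight is their
  orthogonality weight for \<open>\<beta> = q ^ N\<close>, and the value below is the coefficient of \<open>C\<^sub>0\<close> in the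
  expansion of \<open>H\<^sub>2\<^sub>m\<close>. Here it is verified by induction on \<open>N\<close>.\<close>

definition weight_moment :: "real \<Rightarrow> nat \<Rightarrow> nat \<Rightarrow> real" where
  "weight_moment q N m =
     2 * qpoch_fin q (2 * N) * qpoch_fin q (2 * m) * q ^ (N * m) /
     ((1 + q ^ N) * qpoch_fin q N * qpoch_fin q m * qpoch_fin q (N + m))"

context
  fixes q :: real
  assumes q: "0 < q" "q < 1"
begin

lemma one_minus_power_nonzero: "1 - q ^ Suc n \<noteq> 0"
  using power_Suc_less_one[OF q, of n] by simp

lemma one_plus_power_nonzero: "1 + q ^ n \<noteq> 0"
  using zero_less_power[OF q(1), of n] by linarith

text \<open>The ratio of consecutive moments in \<open>N\<close>, cross-multiplied. Together with
  its companion in \<open>m\<close> it reduces \<open>weight_moment_rec\<close> to a polynomial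
  identity.\<close>

lemma weight_moment_Suc_N:
  "weight_moment q (Suc N) m * (1 - q * q ^ N * q ^ m)
     = (1 - q * (q ^ N)\<^sup>2) * (1 + q ^ N) * q ^ m * weight_moment q N m"
proof -
  note nz = qpoch_fin_pos[OF q, THEN less_imp_neq, THEN not_sym]
  have nz1: "1 - q * q ^ N \<noteq> 0" "1 + q * q ^ N \<noteq> 0" "1 - q * q ^ N * q ^ m \<noteq> 0"
    using one_minus_power_nonzero[of N] one_plus_power_nonzero[of "Suc N"]
      one_minus_power_nonzero[of "N + m"] by (simp_all add: power_add mult.assoc)
  \<comment> \<open>The last factor of the longer product is a difference of squares: 1 - q^{2N+2} =
    (1 - q^{N+1}) (1 + q^{N+1}).\<close>
  have e1: "qpoch_fin q (2 * Suc N)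
      = (1 - q * q ^ N) * (1 + q * q ^ N) * (1 - q * (q ^ N)\<^sup>2) * qpoch_fin q (2 * N)"
    by (simp add: qpoch_fin_Suc power_mult algebra_simps power2_eq_square flip: power_mult_distrib)
  have e2: "qpoch_fin q (Suc N + m) = (1 - q * q ^ N * q ^ m) * qpoch_fin q (N + m)"
    by (simp add: qpoch_fin_Suc power_add mult.assoc)
  have e3: "q ^ (Suc N * m) = q ^ m * q ^ (N * m)"
    by (simp add: power_add)
  have e4: "qpoch_fin q (Suc N) = (1 - q * q ^ N) * qpoch_fin q N" "1 + q ^ Suc N = 1 + q * q ^ N"
    by (simp_all add: qpoch_fin_Suc)
  show ?thesis
    unfolding weight_moment_def e1 e2 e3 e4 using nz nz1 one_plus_power_nonzero[of N]
    by (simp add: divide_simps)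
qed

lemma weight_moment_Suc_m:
  "weight_moment q N (Suc m) * (1 - q * q ^ N * q ^ m)
     = (1 - q * (q ^ m)\<^sup>2) * (1 + q * q ^ m) * q ^ N * weight_moment q N m"
proof -
  note nz = qpoch_fin_pos[OF q, THEN less_imp_neq, THEN not_sym]
  have nz1: "1 - q * q ^ m \<noteq> 0" "1 - q * q ^ N * q ^ m \<noteq> 0"
    using one_minus_power_nonzero[of m]
      one_minus_power_nonzero[of "N + m"] by (simp_all add: power_add mult.assoc)
  have e1: "qpoch_fin q (2 * Suc m)
      = (1 - q * q ^ m) * (1 + q * q ^ m) * (1 - q * (q ^ m)\<^sup>2) * qpoch_fin q (2 * m)"
    by (simp add: qpoch_fin_Suc power_mult algebra_simps power2_eq_square flip: power_mult_distrib)
  have e2: "qpoch_fin q (N + Suc m) = (1 - q * q ^ N * q ^ m) * qpoch_fin q (N + m)"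
    by (simp add: qpoch_fin_Suc power_add mult.assoc)
  have e3: "q ^ (N * Suc m) = q ^ N * q ^ (N * m)"
    by (simp add: power_add)
  have e4: "qpoch_fin q (Suc m) = (1 - q * q ^ m) * qpoch_fin q m"
    by (simp add: qpoch_fin_Suc)
  show ?thesis
    unfolding weight_moment_def e1 e2 e3 e4 using nz nz1 one_plus_power_nonzero[of N]
    by (simp add: divide_simps)
qed

text \<open>The recurrence that \<open>qHermite_times_weight_factor\<close>, at
  \<open>T = q ^ N\<close> and degree \<open>2 * m\<close>, imposes on the moments. The two ratios
  express every term by \<open>weight_moment q N m\<close>; after multiplication by the common
  denominator \<open>D\<close> an identity in \<open>q\<close>, \<open>T\<close> and
  \<open>M\<close> remains.\<close>

lemma weight_moment_rec:
  "weight_moment q (Suc N) m =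
     (1 + (q ^ N)\<^sup>2 + q ^ N * q ^ (2 * m) + q ^ N * q ^ Suc (2 * m)) * weight_moment q N m
     - q ^ N * weight_moment q N (Suc m)
     - q ^ N * (1 - q ^ (2 * m)) * (1 - q ^ (2 * m - 1)) * weight_moment q N (m - 1)"
    (is "?l = ?a * ?g - ?b - ?c")
proof -
  define T M where "T = q ^ N" and "M = q ^ m"
  have M2: "q ^ (2 * m) = M\<^sup>2" by (simp add: M_def power_mult mult.commute flip: power_mult)
  \<comment> \<open>Lowering \<open>m\<close> by one leaves no denominator, since the prefactors of
    \<open>?c\<close> cancel it. At \<open>m = 0\<close> both sides vanish, which covers the
    truncated \<open>m - 1\<close>.\<close>
  have c: "?c = (1 - M) * (1 - T * M) * ?g"
  proof (cases m)
    case 0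
    then show ?thesis by (simp add: M_def)
  next
    case (Suc j)
    define J where "J = q ^ j"
    have MJ: "M = q * J" and m1: "m - 1 = j"
      by (simp_all add: M_def J_def Suc)
    have "2 * m - 1 = Suc (j * 2)" by (simp add: Suc)
    then have qm: "q ^ (2 * m - 1) = q * J\<^sup>2"
      by (simp only: J_def power_Suc power_mult)
    have "?c = (1 - M) * ((1 - q * J\<^sup>2) * (1 + q * J) * T * weight_moment q N j)"
      unfolding M2 qm m1 T_def[symmetric] MJ by (simp add: algebra_simps power2_eq_square)
    also have "\<dots> = (1 - M) * (weight_moment q N m * (1 - T * M))"
      using weight_moment_Suc_m[of N j] by (simp add: Suc M_def T_def J_def mult_ac)
    finally show ?thesis by simp
  qed
  define D where "D = 1 - q * T * M"
  have D: "D \<noteq> 0"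
    using one_minus_power_nonzero[of "N + m"] by (simp add: D_def T_def M_def power_add mult.assoc)
  have l: "?l * D = (1 - q * T\<^sup>2) * (1 + T) * M * ?g"
    using weight_moment_Suc_N[of N m] by (simp add: T_def M_def D_def)
  have b: "?b * D = T * ((1 - q * M\<^sup>2) * (1 + q * M) * T * ?g)"
    using weight_moment_Suc_m[of N m] by (simp add: T_def M_def D_def)
  have a: "?a = 1 + T\<^sup>2 + T * M\<^sup>2 + T * (q * M\<^sup>2)"
    by (simp only: T_def[symmetric] power_Suc M2)
  have "(?a * ?g - ?b - ?c) * D = ?a * D * ?g - ?b * D - ?c * D"
    by (simp add: algebra_simps)
  also have "\<dots> = ((1 + T\<^sup>2 + T * M\<^sup>2 + T * (q * M\<^sup>2)) * (1 - q * T * M)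
      - T * ((1 - q * M\<^sup>2) * (1 + q * M) * T) - (1 - M) * (1 - T * M) * (1 - q * T * M)) * ?g"
    unfolding a b c unfolding D_def
    by (simp only: left_diff_distrib[where c = "?g"]) (simp only: mult_ac)
  also have "\<dots> = (1 - q * T\<^sup>2) * (1 + T) * M * ?g"
    by (rule arg_cong[where f = "\<lambda>x. x * ?g"]) algebra
  finally show ?thesis
    using l D by (metis mult_right_cancel)
qed

text \<open>A new weight factor is traded for neighbouring degrees by
  \<open>qHermite_times_weight_factor\<close>, so the induction on \<open>N\<close> must leave
  \<open>n\<close> free. At \<open>N = 0\<close> the moment is a central Gaussian binomial.\<close>

lemma has_integral_qHermite_weight_fin:
  "((\<lambda>t. qHermite q n (cos t) * weight_fin q N (cos t)) has_integral
     (if even n then pi * weight_moment q N (n div 2) else 0)) {0..pi}"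
proof (induction N arbitrary: n)
  case 0
  have "weight_moment q 0 m = gauss_binomial q (2 * m) m" for m
    using gauss_binomial_qpoch_fin[of q m m, folded mult_2] qpoch_fin_pos[OF q, of m]
    by (simp add: weight_moment_def field_simps)
  then show ?case
    using has_integral_qHermite_cos[of q n] by (simp add: weight_fin_def cong: if_cong)
next
  case (Suc N)
  let ?T = "q ^ N"
  let ?I = "\<lambda>n. if even n then pi * weight_moment q N (n div 2) else 0"
  have eq: "qHermite q n y * weight_fin q (Suc N) y
      = (1 + ?T\<^sup>2 + ?T * q ^ n + ?T * q ^ Suc n) * (qHermite q n y * weight_fin q N y)
        - ?T * (qHermite q (Suc (Suc n)) y * weight_fin q N y)
        - ?T * (1 - q ^ n) * (1 - q ^ (n - 1)) * (qHermite q (n - 2) y * weight_fin q N y)" for y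
  proof -
    have "qHermite q n y * weight_fin q (Suc N) y
        = (qHermite q n y * ((1 + ?T)\<^sup>2 - 4 * ?T * y\<^sup>2)) * weight_fin q N y"
      by (simp add: weight_fin_def mult_ac)
    then show ?thesis
      unfolding qHermite_times_weight_factor by (simp only: left_diff_distrib mult.assoc)
  qed
  have "((\<lambda>t. qHermite q n (cos t) * weight_fin q (Suc N) (cos t)) has_integral
      ((1 + ?T\<^sup>2 + ?T * q ^ n + ?T * q ^ Suc n) * ?I n - ?T * ?I (Suc (Suc n))
        - ?T * (1 - q ^ n) * (1 - q ^ (n - 1)) * ?I (n - 2))) {0..pi}"
    unfolding eq by (intro has_integral_diff has_integral_mult_right Suc.IH)
  also have "(1 + ?T\<^sup>2 + ?T * q ^ n + ?T * q ^ Suc n) * ?I n - ?T * ?I (Suc (Suc n))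
        - ?T * (1 - q ^ n) * (1 - q ^ (n - 1)) * ?I (n - 2)
      = (if even n then pi * weight_moment q (Suc N) (n div 2) else 0)"
  proof (cases "even n")
    case True
    then obtain m where m: "n = 2 * m" by (elim evenE)
    have I: "?I n = pi * weight_moment q N m" "?I (Suc (Suc n)) = pi * weight_moment q N (Suc m)"
      "?I (n - 2) = pi * weight_moment q N (m - 1)"
      "(if even n then pi * weight_moment q (Suc N) (n div 2) else 0) = pi * weight_moment q (Suc N) m"
      using m by (simp_all add: diff_mult_distrib2[of 2 m 1, simplified, symmetric])
    show ?thesis
      unfolding I weight_moment_rec[of N m, folded m]
      by (simp only: right_diff_distrib mult_ac)
  next
    case False
    \<comment> \<open>For \<open>n = 1\<close> the truncated \<open>n - 2\<close> is the even number
      0; there the factor \<open>1 - q ^ (n - 1)\<close> vanishes instead.\<close>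
    then have "odd (n - 2) \<or> n - 1 = 0" by presburger
    then have "(1 - q ^ (n - 1)) * ?I (n - 2) = 0" by auto
    then show ?thesis using False by simp
  qed
  finally show ?case .
qed

text \<open>All q-factorials have nonzero limits, so the power \<open>q ^ (N * m)\<close> alone
  decides which moments survive.\<close>

lemma weight_moment_LIMSEQ:
  "(\<lambda>N. weight_moment q N m) \<longlonglongrightarrow> (if m = 0 then 2 / qpoch_inf q q else 0)"
proof -
  let ?Q = "qpoch_inf q q"
  have lim2: "(\<lambda>N. qpoch_fin q (2 * N)) \<longlonglongrightarrow> ?Q"
    using LIMSEQ_subseq_LIMSEQ[OF qpoch_fin_LIMSEQ[OF q], of "\<lambda>N. 2 * N"]
    by (simp add: o_def strict_mono_def)
  have limm: "(\<lambda>N. qpoch_fin q (N + m)) \<longlonglongrightarrow> ?Q"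
    using LIMSEQ_ignore_initial_segment[OF qpoch_fin_LIMSEQ[OF q]] .
  have q0: "(\<lambda>N. q ^ N) \<longlonglongrightarrow> 0"
    using q by (intro LIMSEQ_realpow_zero) auto
  have qm: "(\<lambda>N. q ^ (N * m)) \<longlonglongrightarrow> (if m = 0 then 1 else 0)"
  proof (cases "m = 0")
    case False
    then have "(\<lambda>N. (q ^ m) ^ N) \<longlonglongrightarrow> 0"
      using q by (intro LIMSEQ_realpow_zero) (auto simp: power_less_one_iff)
    then show ?thesis using False by (simp add: mult.commute flip: power_mult)
  qed simp
  have nz: "(1 + 0) * ?Q * qpoch_fin q m * ?Q \<noteq> 0"
    using qpoch_inf_self_nonzero[OF q] qpoch_fin_pos[OF q, of m] by simp
  have "(\<lambda>N. weight_moment q N m) \<longlonglongrightarrow>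
      2 * ?Q * qpoch_fin q (2 * m) * (if m = 0 then 1 else 0) /
        ((1 + 0) * ?Q * qpoch_fin q m * ?Q)"
    unfolding weight_moment_def
    by (intro tendsto_intros lim2 limm q0 qm qpoch_fin_LIMSEQ[OF q] nz)
  then show ?thesis
    using qpoch_inf_self_nonzero[OF q] by (cases "m = 0") simp_all
qed

end

section \<open>Orthogonality of the rescaled polynomials\<close>

definition weight_support :: "real \<Rightarrow> real set" where
  "weight_support q = {- 2 / sqrt (1 - q) .. 2 / sqrt (1 - q)}"

definition qHermite_functional :: "real \<Rightarrow> (real \<Rightarrow> real) \<Rightarrow> real" where
  "qHermite_functional q p =
     qpoch_inf q q / (2 * pi) * integral (weight_support q) (\<lambda>x. p x * qHermite_weight_resc q x)"

lemma qHermite_functional_cmult: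
  "qHermite_functional q (\<lambda>x. c * f x) = c * qHermite_functional q f"
  by (simp add: qHermite_functional_def mult.assoc)

context
  fixes q :: real
  assumes q: "0 < q" "q < 1"
begin

text \<open>Both claims are dominated convergence for the integrands \<open>F N\<close>, followed by
  the substitution x = 2 / sqrt (1 - q) cos t. The integrability gives additivity of the functional,
  and the limit transports the moments of the truncated weights. The index \<open>Suc N\<close>
  guarantees that the factor \<open>i = 0\<close> is present.\<close>

lemma integral_weight_resc_limit:
  assumes p: "continuous_on UNIV p"
  shows "(\<lambda>x. p x * qHermite_weight_resc q x) integrable_on weight_support q"
    and "(\<lambda>N. integral {0..pi} (\<lambda>t. p (2 / sqrt (1 - q) * cos t) * weight_fin q (Suc N) (cos t)))
           \<longlonglongrightarrow> integral (weight_support q) (\<lambda>x. p x * qHermite_weight_resc q x)"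
proof -
  define s where "s = sqrt (1 - q) / 2"
  have s: "s > 0" using q by (simp add: s_def)
  have b: "2 / sqrt (1 - q) = 1 / s" by (simp add: s_def)
  have supp: "weight_support q = {- (1 / s)..1 / s}"
    by (simp add: weight_support_def s_def)
  have ran: "s * x \<in> {-1..1}" if "x \<in> weight_support q" for x
    using that s by (auto simp: supp field_simps)
  have sq1: "(s * x)\<^sup>2 \<le> 1" if "x \<in> weight_support q" for x
    using ran[OF that] by (simp add: abs_square_le_1 abs_le_iff)
  define R where "R N y = (\<Prod>i<N. (1 + q ^ Suc i)\<^sup>2 - 4 * q ^ Suc i * y\<^sup>2)" for N y
  have wR: "weight_fin q (Suc N) y = 4 * (1 - y\<^sup>2) * R N y" for N y
    by (simp add: weight_fin_def R_def prod.lessThan_Suc_shift algebra_simps power2_eq_square del: prod.lessThan_Suc)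
  \<comment> \<open>The factor \<open>i = 0\<close> of the weight cancels the singularity of the arcsine density, so the
    truncated integrands are continuous up to the endpoints.\<close>
  define F where "F N x = p x * (4 * s * sqrt (1 - (s * x)\<^sup>2) * R N (s * x))" for N x
  have F_eq: "F N x = p x * (weight_fin q (Suc N) (s * x) * s / sqrt (1 - (s * x)\<^sup>2))"
    if "x \<in> weight_support q" for N x
  \<comment> \<open>At the endpoints the root is 0, and division by zero yields 0, so both sides
    agree there as well.\<close>
  proof (cases "(s * x)\<^sup>2 = 1")
    case False
    with sq1[OF that] have "1 - (s * x)\<^sup>2 > 0" by simp
    then have "1 - (s * x)\<^sup>2 = sqrt (1 - (s * x)\<^sup>2) * sqrt (1 - (s * x)\<^sup>2)"
      and "sqrt (1 - (s * x)\<^sup>2) > 0" by simp_all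
    moreover have "a * (4 * b * r * c) = a * (4 * d * c * b / r)"
      if "d = r * r" "r > 0" for a b c d r :: real
      using that by simp
    ultimately show ?thesis
      unfolding F_def wR by blast
  qed (simp add: F_def)
  have cont_F: "continuous_on A (F N)" for N A
    unfolding F_def R_def
    by (intro continuous_intros continuous_on_subset[OF p]) auto
  \<comment> \<open>The bound is uniform in \<open>N\<close> because \<open>4 * R N 0\<close> is the
    truncated weight at angle \<open>pi / 2\<close>, a convergent sequence.\<close>
  obtain C where C: "R N 0 \<le> C" for N
  proof -
    have "convergent (\<lambda>N. weight_fin q N (cos (pi / 2)))"
      using weight_fin_LIMSEQ[OF q] by (rule convergentI)
    then have "Bseq (\<lambda>N. weight_fin q N (cos (pi / 2)))" by (rule convergent_imp_Bseq)
    then obtain K where "\<And>N. norm (weight_fin q N (cos (pi / 2))) \<le> K"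
      unfolding Bseq_def by blast
    then have "norm (weight_fin q (Suc N) 0) \<le> K" for N
      by (metis cos_pi_half)
    then have K: "\<bar>4 * R N 0\<bar> \<le> K" for N
      unfolding wR real_norm_def by simp
    have "R N 0 \<le> K / 4" for N
      using K[of N] by linarith
    then show ?thesis using that by blast
  qed
  \<comment> \<open>Each factor decreases in \<open>y\<^sup>2\<close> and equals a square at
    \<open>y\<^sup>2 = 1\<close>; hence it is nonnegative and largest at
    \<open>y = 0\<close>.\<close>
  have R_bound: "\<bar>R N y\<bar> \<le> C" if "y\<^sup>2 \<le> 1" for N y
  proof -
    have nonneg: "0 \<le> (1 + q ^ Suc i)\<^sup>2 - 4 * q ^ Suc i * y\<^sup>2" for i
    proof -
      have "4 * q ^ Suc i * y\<^sup>2 \<le> 4 * q ^ Suc i * 1"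
        using that q by (intro mult_left_mono) auto
      moreover have "(1 + q ^ Suc i)\<^sup>2 - 4 * q ^ Suc i = (1 - q ^ Suc i)\<^sup>2"
        by (simp add: power2_eq_square algebra_simps)
      ultimately show ?thesis by (smt (verit) zero_le_power2)
    qed
    have "R N y \<le> R N 0"
      unfolding R_def using nonneg q by (intro prod_mono) auto
    moreover have "0 \<le> R N y"
      unfolding R_def using nonneg by (intro prod_nonneg) auto
    ultimately show ?thesis using C[of N] by linarith
  qed
  have "compact (p ` weight_support q)"
    unfolding weight_support_def
    by (intro compact_continuous_image continuous_on_subset[OF p]) auto
  then obtain B where B: "\<bar>p x\<bar> \<le> B" if "x \<in> weight_support q" for x
    by (metis compact_imp_bounded bounded_iff image_eqI real_norm_def)
  have F_bound: "norm (F N x) \<le> B * (4 * s * 1 * C)" if x: "x \<in> weight_support q" for N x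
  proof -
    have "sqrt (1 - (s * x)\<^sup>2) \<le> 1" "0 \<le> sqrt (1 - (s * x)\<^sup>2)"
      using sq1[OF x] by simp_all
    moreover have "0 \<le> B" "0 \<le> C"
      using B[OF x] R_bound[of 0 0] by (auto intro: order_trans[OF abs_ge_zero])
    ultimately show ?thesis
      unfolding F_def real_norm_def abs_mult using s B[OF x] R_bound[OF sq1[OF x]]
      by (intro mult_mono) (auto intro!: mult_nonneg_nonneg)
  qed
  have F_lim: "(\<lambda>N. F N x) \<longlonglongrightarrow> p x * qHermite_weight_resc q x" if x: "x \<in> weight_support q" for x
  proof -
    have "(\<lambda>N. weight_fin q (Suc N) (s * x)) \<longlonglongrightarrow> qHermite_weight q (s * x)"
      using LIMSEQ_Suc[OF weight_fin_LIMSEQ[OF q, of "arccos (s * x)"]] ran[OF x] by simp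
    moreover have "qHermite_weight_resc q x = qHermite_weight q (s * x) * s / sqrt (1 - (s * x)\<^sup>2)"
      using q by (simp add: qHermite_weight_resc_def s_def power_mult_distrib power_divide)
    ultimately show ?thesis
      unfolding F_eq[OF x] by (auto intro!: tendsto_intros simp only: divide_inverse)
  qed
  have F_int: "F N integrable_on weight_support q" for N
    unfolding supp using cont_F by (rule integrable_continuous_real)
  have const_int: "(\<lambda>_. B * (4 * s * 1 * C)) integrable_on weight_support q"
    unfolding supp by (rule integrable_const_ivl)
  show "(\<lambda>x. p x * qHermite_weight_resc q x) integrable_on weight_support q"
    using F_int const_int F_bound F_lim by (rule dominated_convergence(1))
  have lim: "(\<lambda>N. integral (weight_support q) (F N))
      \<longlonglongrightarrow> integral (weight_support q) (\<lambda>x. p x * qHermite_weight_resc q x)"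
    using F_int const_int F_bound F_lim by (rule dominated_convergence(2))
  have "integral (weight_support q) (F N)
      = integral {0..pi} (\<lambda>t. p (2 / sqrt (1 - q) * cos t) * weight_fin q (Suc N) (cos t))" for N
  proof -
    have deriv: "((\<lambda>t. cos t / s) has_field_derivative - sin t / s) (at t within {0..pi})" for t
      using s by (auto intro!: derivative_eq_intros)
    have "(\<lambda>t. cos t / s) ` {0..pi} \<subseteq> weight_support q"
      using s by (auto simp: supp field_simps)
    then have "((\<lambda>t. (- sin t / s) *\<^sub>R F N (cos t / s)) has_integral
        (integral {cos 0 / s..cos pi / s} (F N) - integral {cos pi / s..cos 0 / s} (F N))) {0..pi}"
      unfolding supp
      by (rule has_integral_substitution_general[OF finite.emptyI pi_ge_zero _ cont_F
            DERIV_continuous_on[OF deriv] deriv])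
    \<comment> \<open>The cosine reverses orientation, so this interval is empty; the other integral
      remains, with a minus sign.\<close>
    moreover have "integral {cos 0 / s..cos pi / s} (F N) = 0"
      using s by simp
    moreover have "{cos pi / s..cos 0 / s} = weight_support q"
      by (simp add: supp)
    ultimately have "((\<lambda>t. (- sin t / s) *\<^sub>R F N (cos t / s)) has_integral
        - integral (weight_support q) (F N)) {0..pi}"
      by simp
    from has_integral_neg[OF this] have "((\<lambda>t. - ((- sin t / s) *\<^sub>R F N (cos t / s))) has_integral
        integral (weight_support q) (F N)) {0..pi}"
      by simp
    then have "integral (weight_support q) (F N)
        = integral {0..pi} (\<lambda>t. - ((- sin t / s) *\<^sub>R F N (cos t / s)))"
      by (rule integral_unique[symmetric])
    also have "\<dots> = integral {0..pi} (\<lambda>t. p (2 / sqrt (1 - q) * cos t) * weight_fin q (Suc N) (cos t))"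
    proof (rule integral_cong)
      fix t assume "t \<in> {0..pi}"
      \<comment> \<open>The root in \<open>F\<close> becomes \<open>sin t\<close>; with the Jacobian
        it restores the factor \<open>i = 0\<close>, which is
        \<open>4 * (1 - (cos t)\<^sup>2)\<close>.\<close>
      then have "0 \<le> sin t" by (auto intro: sin_ge_zero)
      moreover have "1 - (cos t)\<^sup>2 = sin t * sin t"
        by (simp add: sin_squared_eq[symmetric] power2_eq_square[of "sin t"])
      ultimately show "- ((- sin t / s) *\<^sub>R F N (cos t / s))
          = p (2 / sqrt (1 - q) * cos t) * weight_fin q (Suc N) (cos t)"
        using s unfolding b by (simp add: F_def wR)
    qed
    finally show ?thesis .
  qed
  with lim show "(\<lambda>N. integral {0..pi} (\<lambda>t. p (2 / sqrt (1 - q) * cos t) * weight_fin q (Suc N) (cos t)))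
      \<longlonglongrightarrow> integral (weight_support q) (\<lambda>x. p x * qHermite_weight_resc q x)"
    by simp
qed

lemma continuous_on_qHermite: "continuous_on A (\<lambda>x. qHermite q n (f x))"
  if "continuous_on A f" for f :: "real \<Rightarrow> real"
  using that by (induction q n "0::real" rule: qHermite.induct) (auto intro!: continuous_intros)

lemma powr_half_eq: "(1 - q) powr (real n / 2) = sqrt (1 - q) ^ n"
  using q by (simp add: powr_half_sqrt[symmetric] powr_powr flip: powr_realpow)

lemma continuous_on_qHermite_resc [continuous_intros]: "continuous_on A (qHermite_resc q n)"
  unfolding qHermite_resc_def powr_half_eq[abs_def]
  using q by (intro continuous_on_divide continuous_on_qHermite continuous_intros) auto

lemma qHermite_resc_0: "qHermite_resc q 0 x = 1"
  using q by (simp add: qHermite_resc_def)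

lemma qHermite_resc_1: "qHermite_resc q (Suc 0) x = x"
  using q by (simp add: qHermite_resc_def powr_half_sqrt)

text \<open>Rescaling divides the recurrence by a power of \<open>r = sqrt (1 - q)\<close>, and 1 -
  q^{n+1} divided by \<open>r\<^sup>2\<close> is the q-integer [n+1]_q.\<close>

lemma qHermite_resc_mult:
  "qHermite_resc q (Suc 0) x * qHermite_resc q (Suc n) x =
     qHermite_resc q (Suc (Suc n)) x + (\<Sum>j<Suc n. q ^ j) * qHermite_resc q n x"
proof -
  define r where "r = sqrt (1 - q)"
  have r: "r > 0" "r\<^sup>2 = 1 - q" using q by (simp_all add: r_def)
  have geo: "1 - q ^ Suc n = r\<^sup>2 * (\<Sum>j<Suc n. q ^ j)"
    unfolding r using one_diff_power_eq[of q "Suc n"] by simp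
  have "qHermite q (Suc (Suc n)) (r / 2 * x)
      = r * x * qHermite q (Suc n) (r / 2 * x) - r\<^sup>2 * (\<Sum>j<Suc n. q ^ j) * qHermite q n (r / 2 * x)"
    unfolding qHermite.simps geo by simp
  then show ?thesis
    unfolding qHermite_resc_1 unfolding qHermite_resc_def powr_half_eq r_def[symmetric]
    using r(1) by (simp add: field_simps power2_eq_square del: qHermite.simps sum.lessThan_Suc)
qed

lemma qHermite_functional_add:
  assumes "continuous_on UNIV f" "continuous_on UNIV g"
  shows "qHermite_functional q (\<lambda>x. f x + g x) = qHermite_functional q f + qHermite_functional q g"
  using integral_add[OF integral_weight_resc_limit(1)[OF assms(1)] integral_weight_resc_limit(1)[OF assms(2)]]
  by (simp add: qHermite_functional_def distrib_left distrib_right)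

text \<open>In the angular variable these are the moments of the truncated weights divided by
  \<open>r ^ n\<close>. Only \<open>n = 0\<close> survives the limit, and the prefactor of the
  functional normalises it.\<close>

lemma qHermite_functional_resc:
  "qHermite_functional q (qHermite_resc q n) = (if n = 0 then 1 else 0)"
proof -
  define r where "r = sqrt (1 - q)"
  have r: "r > 0" using q by (simp add: r_def)
  let ?m = "\<lambda>N. if even n then pi * weight_moment q (Suc N) (n div 2) else 0"
  have "qHermite_resc q n (2 / r * cos t) = qHermite q n (cos t) / r ^ n" for t
    using r by (simp add: qHermite_resc_def powr_half_eq flip: r_def)
  then have "integral {0..pi} (\<lambda>t. qHermite_resc q n (2 / r * cos t) * weight_fin q (Suc N) (cos t))
      = ?m N / r ^ n" for N
    using has_integral_divide[OF has_integral_qHermite_weight_fin[OF q, of n "Suc N"], of "r ^ n"]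
    by (intro integral_unique) simp
  then have "(\<lambda>N. ?m N / r ^ n) \<longlonglongrightarrow>
      integral (weight_support q) (\<lambda>x. qHermite_resc q n x * qHermite_weight_resc q x)"
    using integral_weight_resc_limit(2)[OF continuous_on_qHermite_resc, of n] by (simp add: r_def)
  moreover have "(\<lambda>N. ?m N / r ^ n) \<longlonglongrightarrow> (if n = 0 then 2 * pi / qpoch_inf q q else 0)"
  proof (cases "even n")
    case True
    have "(\<lambda>N. pi * weight_moment q (Suc N) (n div 2) / r ^ n) \<longlonglongrightarrow>
        pi * (if n div 2 = 0 then 2 / qpoch_inf q q else 0) / r ^ n"
      using r LIMSEQ_Suc[OF weight_moment_LIMSEQ[OF q]] by (intro tendsto_intros) auto
    moreover have "n div 2 = 0 \<longleftrightarrow> n = 0" using True by auto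
    ultimately show ?thesis using True by (cases "n = 0") (simp_all add: mult.commute)
  qed (auto intro!: tendsto_intros)
  ultimately have "integral (weight_support q) (\<lambda>x. qHermite_resc q n x * qHermite_weight_resc q x)
      = (if n = 0 then 2 * pi / qpoch_inf q q else 0)"
    by (rule LIMSEQ_unique)
  then show ?thesis
    using qpoch_inf_self_nonzero[OF q] by (simp add: qHermite_functional_def)
qed

end

section \<open>Crossings of coloured matchings\<close>

definition crosses :: "nat set \<Rightarrow> nat set \<Rightarrow> bool" where
  "crosses e f \<longleftrightarrow>
     (\<exists>i1 j1 i2 j2. e = {i1, j1} \<and> f = {i2, j2} \<and> i1 < i2 \<and> i2 < j1 \<and> j1 < j2)"

lemma crosses_iff:
  assumes "i1 < j1" "i2 < j2"
  shows "crosses {i1, j1} {i2, j2} \<longleftrightarrow> i1 < i2 \<and> i2 < j1 \<and> j1 < j2"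
  using assms by (auto simp: crosses_def doubleton_eq_iff)

lemma crosses_asym: "crosses e f \<Longrightarrow> \<not> crosses f e"
  unfolding crosses_def by (force simp: doubleton_eq_iff)

text \<open>Crossing pairs are split by whether \<open>e\<close> is absent, first or second. By
  \<open>crosses_asym\<close>, \<open>e\<close> does not cross itself and no edge is counted in both
  of the last two groups.\<close>

lemma crossing_number_insert:
  assumes "finite \<sigma>" "e \<notin> \<sigma>"
  shows "crossing_number (insert e \<sigma>)
           = crossing_number \<sigma> + card {f \<in> \<sigma>. crosses e f \<or> crosses f e}"
proof -
  let ?X = "{(e1, e2). e1 \<in> \<sigma> \<and> e2 \<in> \<sigma> \<and> crosses e1 e2}"
  let ?Y = "Pair e ` {f \<in> \<sigma>. crosses e f}" and ?Z = "(\<lambda>f. (f, e)) ` {f \<in> \<sigma>. crosses f e}"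
  have fin: "finite ?X" "finite ?Y" "finite ?Z"
    using assms(1) by (auto intro: finite_subset[of _ "\<sigma> \<times> \<sigma>"])
  have "{(e1, e2). e1 \<in> insert e \<sigma> \<and> e2 \<in> insert e \<sigma> \<and> crosses e1 e2} = ?X \<union> (?Y \<union> ?Z)"
    using crosses_asym[of e e] by auto
  then have "crossing_number (insert e \<sigma>) = card (?X \<union> (?Y \<union> ?Z))"
    by (simp add: crossing_number_def crosses_def)
  also have "\<dots> = card ?X + (card ?Y + card ?Z)"
    using fin assms(2) by (subst card_Un_disjoint, auto)+
  also have "card ?X = crossing_number \<sigma>"
    by (simp add: crossing_number_def crosses_def)
  also have "card ?Y + card ?Z = card {f \<in> \<sigma>. crosses e f} + card {f \<in> \<sigma>. crosses f e}"
    by (simp add: card_image inj_on_def)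
  also have "\<dots> = card ({f \<in> \<sigma>. crosses e f} \<union> {f \<in> \<sigma>. crosses f e})"
    using assms(1) crosses_asym by (subst card_Un_disjoint) auto
  also have "{f \<in> \<sigma>. crosses e f} \<union> {f \<in> \<sigma>. crosses f e} = {f \<in> \<sigma>. crosses e f \<or> crosses f e}"
    by auto
  finally show ?thesis .
qed

lemma complete_matching_finite: "finite A \<Longrightarrow> complete_matching A \<sigma> \<Longrightarrow> finite \<sigma>"
  unfolding complete_matching_def using finite_elements by blast

lemma complete_matching_edgeE:
  assumes "complete_matching A \<sigma>" "f \<in> \<sigma>"
  obtains x y where "f = {x, y}" "x < y" "x \<in> A" "y \<in> A"
proof -
  have "card f = 2" "f \<subseteq> A"
    using assms by (auto simp: complete_matching_def partition_on_def)
  then obtain x y where "f = {x, y}" "x \<noteq> y" by (auto simp: card_2_iff)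
  with \<open>f \<subseteq> A\<close> show ?thesis
    using that[of x y] that[of y x] by (cases "x < y") (auto simp: insert_commute)
qed

lemma complete_matching_insert:
  assumes "card e = 2" "e \<inter> \<Union>\<sigma> = {}"
  shows "complete_matching A (insert e \<sigma>) \<longleftrightarrow> complete_matching (A - e) \<sigma> \<and> e \<subseteq> A"
proof -
  have "e \<noteq> {}" using assms(1) by auto
  then show ?thesis
    using assms partition_on_insert[of e \<sigma> A] by (auto simp: complete_matching_def disjnt_def)
qed

text \<open>An edge disjoint from \<open>{p, p'}\<close> crosses it iff exactly one of its ends lies
  strictly between \<open>p\<close> and \<open>p'\<close>. No edge has both ends there, so edges
  that cross correspond to inner points.\<close>

lemma card_edges_crossing:
  assumes A: "finite A" and \<sigma>: "complete_matching A \<sigma>" and p: "p < p'" "p \<notin> A" "p' \<notin> A"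
    and no_inner: "\<And>f. f \<in> \<sigma> \<Longrightarrow> \<not> f \<subseteq> {p<..<p'}"
  shows "card {f \<in> \<sigma>. crosses {p, p'} f \<or> crosses f {p, p'}} = card (A \<inter> {p<..<p'})"
proof -
  have U: "\<Union>\<sigma> = A" and disj: "disjoint \<sigma>"
    using \<sigma> by (auto simp: complete_matching_def partition_on_def)
  have fin: "finite \<sigma>" using complete_matching_finite[OF A \<sigma>] .
  have one: "card (f \<inter> {p<..<p'}) = (if crosses {p, p'} f \<or> crosses f {p, p'} then 1 else 0)"
    if f_in: "f \<in> \<sigma>" for f
  proof -
    obtain x y where f: "f = {x, y}" "x < y" "x \<in> A" "y \<in> A"
      using complete_matching_edgeE[OF \<sigma> f_in] .
    have ne: "x \<noteq> p" "x \<noteq> p'" "y \<noteq> p" "y \<noteq> p'" using f p by auto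
    have out: "\<not> (p < x \<and> y < p')" using no_inner[OF f_in] f by auto
    have "p < x \<and> x < p' \<or> p < y \<and> y < p' \<and> \<not> p < x \<or> (x < p \<or> p' < x) \<and> (y < p \<or> p' < y)"
      using ne f(2) by arith
    then consider "p < x" "x < p'" | "p < y" "y < p'" "\<not> p < x" | "x < p \<or> p' < x" "y < p \<or> p' < y"
      by blast
    then show ?thesis
    proof cases
      case 1
      then have "f \<inter> {p<..<p'} = {x}" using f out by auto
      then show ?thesis using 1 f out ne p by (simp add: crosses_iff)
    next
      case 2
      then have "f \<inter> {p<..<p'} = {y}" using f out by auto
      then show ?thesis using 2 f out ne p by (simp add: crosses_iff)
    next
      case 3
      then have "f \<inter> {p<..<p'} = {}" using f out by auto
      then show ?thesis using 3 f out ne p by (auto simp: crosses_iff)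
    qed
  qed
  have "card (A \<inter> {p<..<p'}) = card (\<Union>f\<in>\<sigma>. f \<inter> {p<..<p'})"
    by (rule arg_cong[where f = card]) (use U in blast)
  also have "\<dots> = (\<Sum>f\<in>\<sigma>. card (f \<inter> {p<..<p'}))"
    using fin disj by (intro card_UN_disjoint) (auto simp: disjoint_def)
  also have "\<dots> = (\<Sum>f\<in>\<sigma>. if crosses {p, p'} f \<or> crosses f {p, p'} then 1 else 0)"
    by (intro sum.cong refl one)
  also have "\<dots> = card {f \<in> \<sigma>. crosses {p, p'} f \<or> crosses f {p, p'}}"
    using fin by (simp add: sum.If_cases Int_def)
  finally show ?thesis ..
qed

section \<open>Coloured matchings and splitting a point off a block\<close>

text \<open>Colours encode the blocks: injectivity on a two-element edge forbids joining points of
  one block. Points of \<open>S\<^sub>0\<close> will receive distinct colours, which leaves edges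
  among them free.\<close>

definition coloured_matchings :: "nat set \<Rightarrow> (nat \<Rightarrow> nat) \<Rightarrow> nat set set set" where
  "coloured_matchings A c = {\<sigma>. complete_matching A \<sigma> \<and> (\<forall>e\<in>\<sigma>. inj_on c e)}"

definition crossing_sum :: "real \<Rightarrow> nat set \<Rightarrow> (nat \<Rightarrow> nat) \<Rightarrow> real" where
  "crossing_sum q A c = (\<Sum>\<sigma>\<in>coloured_matchings A c. q ^ crossing_number \<sigma>)"

text \<open>Blocks are intervals relative to \<open>A\<close> rather than to all integers, so that
  the property survives the removal of points.\<close>

definition contiguous :: "nat set \<Rightarrow> (nat \<Rightarrow> nat) \<Rightarrow> bool" where
  "contiguous A c \<longleftrightarrow>
     (\<forall>x\<in>A. \<forall>y\<in>A. \<forall>z\<in>A. x < y \<longrightarrow> y < z \<longrightarrow> c x = c z \<longrightarrow> c y = c x)"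

lemma contiguousD:
  "contiguous A c \<Longrightarrow> x \<in> A \<Longrightarrow> y \<in> A \<Longrightarrow> z \<in> A \<Longrightarrow> x < y \<Longrightarrow> y < z \<Longrightarrow> c x = c z \<Longrightarrow> c y = c x"
  unfolding contiguous_def by blast

lemma contiguous_subset: "contiguous A c \<Longrightarrow> B \<subseteq> A \<Longrightarrow> contiguous B c"
  unfolding contiguous_def by blast

lemma finite_coloured_matchings: "finite A \<Longrightarrow> finite (coloured_matchings A c)"
  by (rule finite_subset[of _ "Pow (Pow A)"])
    (auto simp: coloured_matchings_def complete_matching_def partition_on_def)

text \<open>Removing \<open>{p, p'}\<close> is a bijection onto the matchings of the remaining
  points. The other edges avoid \<open>p\<close> and do not see its new colour, so the exponent only
  loses the crossings with the removed edge.\<close>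

lemma coloured_matchings_with_edge:
  assumes A: "finite A" "contiguous A c" and p: "p \<in> A" "p' \<in> A" "p < p'" "c p = c p'"
    and new: "new \<notin> c ` A"
  shows "(\<Sum>\<sigma> | \<sigma> \<in> coloured_matchings A (c(p := new)) \<and> {p, p'} \<in> \<sigma>. q ^ crossing_number \<sigma>)
           = q ^ card {x \<in> A. p < x \<and> x < p'} * crossing_sum q (A - {p, p'}) c"
proof -
  let ?e = "{p, p'}" and ?c = "c(p := new)"
  have card_e: "card ?e = 2" using p by simp
  have remove: "\<sigma> - {?e} \<in> coloured_matchings (A - ?e) c"
    if \<sigma>: "\<sigma> \<in> coloured_matchings A ?c" "?e \<in> \<sigma>" for \<sigma>
  proof -
    have m: "complete_matching A \<sigma>" and inj: "\<And>e. e \<in> \<sigma> \<Longrightarrow> inj_on ?c e"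
      using \<sigma> by (auto simp: coloured_matchings_def)
    have d: "?e \<inter> \<Union>(\<sigma> - {?e}) = {}"
    proof -
      have "?e \<inter> f = {}" if "f \<in> \<sigma> - {?e}" for f
        using m \<sigma>(2) that disjointD[of \<sigma> ?e f]
        by (auto simp: complete_matching_def partition_on_def)
      then show ?thesis by blast
    qed
    have "complete_matching (A - ?e) (\<sigma> - {?e})"
      using complete_matching_insert[OF card_e d, of A] m \<sigma>(2) by (simp add: insert_absorb)
    moreover have "inj_on c e" if "e \<in> \<sigma> - {?e}" for e
    proof -
      have "p \<notin> e" using d that by blast
      then have "inj_on ?c e = inj_on c e" by (intro inj_on_cong) auto
      then show ?thesis using inj[of e] that by blast
    qed
    ultimately show ?thesis by (simp add: coloured_matchings_def)
  qed
  have add: "insert ?e \<tau> \<in> coloured_matchings A ?c" and not_in: "?e \<notin> \<tau>"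
    and cr: "crossing_number (insert ?e \<tau>) = crossing_number \<tau> + card {x \<in> A. p < x \<and> x < p'}"
    if \<tau>: "\<tau> \<in> coloured_matchings (A - ?e) c" for \<tau>
  proof -
    have m: "complete_matching (A - ?e) \<tau>" and inj: "\<And>e. e \<in> \<tau> \<Longrightarrow> inj_on c e"
      using \<tau> by (auto simp: coloured_matchings_def)
    have sub: "\<Union>\<tau> = A - ?e" using m by (auto simp: complete_matching_def partition_on_def)
    then show "?e \<notin> \<tau>" by auto
    have "complete_matching A (insert ?e \<tau>)"
      using complete_matching_insert[OF card_e, of \<tau> A] m sub p by auto
    moreover have "inj_on ?c e" if "e \<in> \<tau>" for e
    proof -
      have "p \<notin> e" using sub that by auto
      then have "inj_on ?c e = inj_on c e" by (intro inj_on_cong) auto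
      then show ?thesis using inj[OF that] by blast
    qed
    moreover have "inj_on ?c ?e" using new p by auto
    ultimately show "insert ?e \<tau> \<in> coloured_matchings A ?c"
      by (simp add: coloured_matchings_def)
    \<comment> \<open>By contiguity all points between \<open>p\<close> and \<open>p'\<close> share
      their colour, so no edge can join two of them.\<close>
    have "\<not> f \<subseteq> {p<..<p'}" if f_in: "f \<in> \<tau>" for f
    proof
      assume f: "f \<subseteq> {p<..<p'}"
      obtain x y where xy: "f = {x, y}" "x < y" "x \<in> A - ?e" "y \<in> A - ?e"
        using complete_matching_edgeE[OF m f_in] .
      have "c x = c p" "c y = c p"
        using contiguousD[OF A(2) p(1) _ p(2)] xy f p by auto
      then show False using inj[OF f_in] xy by auto
    qed
    then have "card {f \<in> \<tau>. crosses ?e f \<or> crosses f ?e} = card ((A - ?e) \<inter> {p<..<p'})"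
      using A p by (intro card_edges_crossing[OF _ m]) auto
    also have "(A - ?e) \<inter> {p<..<p'} = {x \<in> A. p < x \<and> x < p'}" by auto
    finally show "crossing_number (insert ?e \<tau>) = crossing_number \<tau> + card {x \<in> A. p < x \<and> x < p'}"
      using crossing_number_insert[OF complete_matching_finite[OF _ m] \<open>?e \<notin> \<tau>\<close>] A by simp
  qed
  have cr': "crossing_number \<sigma> = crossing_number (\<sigma> - {?e}) + card {x \<in> A. p < x \<and> x < p'}"
    if "\<sigma> \<in> coloured_matchings A ?c" "?e \<in> \<sigma>" for \<sigma>
    using cr[OF remove[OF that]] insert_Diff[OF that(2)] by simp
  have "(\<Sum>\<sigma> | \<sigma> \<in> coloured_matchings A ?c \<and> ?e \<in> \<sigma>. q ^ crossing_number \<sigma>)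
      = (\<Sum>\<tau>\<in>coloured_matchings (A - ?e) c. q ^ card {x \<in> A. p < x \<and> x < p'} * q ^ crossing_number \<tau>)"
    by (rule sum.reindex_bij_witness[of _ "insert ?e" "\<lambda>\<sigma>. \<sigma> - {?e}"])
      (use remove add not_in cr' in \<open>auto simp: insert_absorb power_add\<close>)
  then show ?thesis by (simp add: crossing_sum_def sum_distrib_left)
qed

text \<open>Giving \<open>p\<close> its own colour only adds matchings, namely those that join
  \<open>p\<close> to another point \<open>p'\<close> of its former block. They are sorted by
  \<open>p'\<close>, and minimality of \<open>p\<close> makes the exponent the rank of
  \<open>p'\<close> in the rest of the block.\<close>

lemma crossing_sum_split:
  assumes A: "finite A" "contiguous A c" and p: "p \<in> A" "\<And>x. x \<in> A \<Longrightarrow> c x = c p \<Longrightarrow> p \<le> x"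
    and new: "new \<notin> c ` A"
  defines "B \<equiv> {x \<in> A. c x = c p}"
  shows "crossing_sum q A (c(p := new)) = crossing_sum q A c
           + (\<Sum>p'\<in>B - {p}. q ^ card {x \<in> B - {p}. x < p'} * crossing_sum q (A - {p, p'}) c)"
proof -
  let ?c = "c(p := new)" and ?M = "coloured_matchings A"
  let ?X = "\<lambda>p'. {\<sigma> \<in> ?M (c(p := new)). {p, p'} \<in> \<sigma>}"
  have sub: "e \<subseteq> A" if "\<sigma> \<in> ?M d" "e \<in> \<sigma>" for d \<sigma> e
    using that by (auto simp: coloured_matchings_def complete_matching_def partition_on_def)
  have "?M ?c = ?M c \<union> (\<Union>p'\<in>B - {p}. ?X p')"
  proof (intro equalityI subsetI)
    fix \<sigma> assume \<sigma>: "\<sigma> \<in> ?M ?c"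
    then have m: "complete_matching A \<sigma>" and inj: "\<And>e. e \<in> \<sigma> \<Longrightarrow> inj_on ?c e"
      by (auto simp: coloured_matchings_def)
    show "\<sigma> \<in> ?M c \<union> (\<Union>p'\<in>B - {p}. ?X p')"
    proof (cases "\<sigma> \<in> ?M c")
      case False
      then obtain e where e: "e \<in> \<sigma>" "\<not> inj_on c e"
        using m by (auto simp: coloured_matchings_def)
      obtain x y where xy: "e = {x, y}" "x < y" "x \<in> A" "y \<in> A"
        using complete_matching_edgeE[OF m e(1)] .
      have c: "c x = c y" "?c x \<noteq> ?c y"
        using e xy inj[OF e(1)] by auto
      \<comment> \<open>Only the colour of \<open>p\<close> has changed, so the edge contains
        \<open>p\<close>; as the least point of its block, \<open>p\<close> is the left end.\<close>
      then have "x = p \<or> y = p" by (metis fun_upd_other)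
      then have "x = p" using p(2)[OF xy(3)] c xy by auto
      then have "y \<in> B - {p}" "e = {p, y}" using c xy by (auto simp: B_def)
      then show ?thesis using \<sigma> e(1) by blast
    qed simp
  next
    fix \<sigma> assume "\<sigma> \<in> ?M c \<union> (\<Union>p'\<in>B - {p}. ?X p')"
    then show "\<sigma> \<in> ?M ?c"
    proof
      assume \<sigma>: "\<sigma> \<in> ?M c"
      have "inj_on ?c e" if "e \<in> \<sigma>" for e
      proof -
        have "inj_on c e" using \<sigma> that by (simp add: coloured_matchings_def)
        then show ?thesis
          using new sub[OF \<sigma> that] by (simp add: inj_on_def) blast
      qed
      then show ?thesis using \<sigma> by (simp add: coloured_matchings_def)
    qed auto
  qed
  then have "crossing_sum q A ?c = (\<Sum>\<sigma>\<in>?M c \<union> (\<Union>p'\<in>B - {p}. ?X p'). q ^ crossing_number \<sigma>)"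
    by (simp add: crossing_sum_def)
  also have "\<dots> = crossing_sum q A c + (\<Sum>\<sigma>\<in>(\<Union>p'\<in>B - {p}. ?X p'). q ^ crossing_number \<sigma>)"
    unfolding crossing_sum_def
  proof (rule sum.union_disjoint)
    show "?M c \<inter> (\<Union>p'\<in>B - {p}. ?X p') = {}"
    proof -
      have False if "\<sigma> \<in> ?M c" "p' \<in> B - {p}" "{p, p'} \<in> \<sigma>" for \<sigma> p'
      proof -
        have "inj_on c {p, p'}" using that unfolding coloured_matchings_def by blast
        moreover have "c p' = c p" "p' \<noteq> p" using that(2) by (auto simp: B_def)
        ultimately show False by (simp add: inj_on_def)
      qed
      then show ?thesis by blast
    qed
  qed (use A in \<open>auto simp: finite_coloured_matchings B_def\<close>)
  also have "(\<Sum>\<sigma>\<in>(\<Union>p'\<in>B - {p}. ?X p'). q ^ crossing_number \<sigma>)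
      = (\<Sum>p'\<in>B - {p}. \<Sum>\<sigma>\<in>?X p'. q ^ crossing_number \<sigma>)"
  proof (rule sum.UNION_disjoint)
    \<comment> \<open>Two different edges through \<open>p\<close> cannot both be blocks of one
      partition.\<close>
    show "\<forall>i\<in>B - {p}. \<forall>j\<in>B - {p}. i \<noteq> j \<longrightarrow> ?X i \<inter> ?X j = {}"
    proof (intro ballI impI)
      fix i j assume "i \<in> B - {p}" "j \<in> B - {p}" "i \<noteq> j"
      then have "{p, i} \<noteq> {p, j}" by (auto simp: doubleton_eq_iff)
      moreover have "disjoint \<sigma>" if "\<sigma> \<in> ?M ?c" for \<sigma>
        using that by (simp add: coloured_matchings_def complete_matching_def partition_on_def)
      ultimately show "?X i \<inter> ?X j = {}"
        using disjointD by blast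
    qed
  qed (use A in \<open>auto simp: finite_coloured_matchings B_def\<close>)
  also have "\<dots> = (\<Sum>p'\<in>B - {p}. q ^ card {x \<in> B - {p}. x < p'} * crossing_sum q (A - {p, p'}) c)"
  proof (rule sum.cong[OF refl])
    fix p' assume "p' \<in> B - {p}"
    then have p': "p' \<in> A" "p < p'" "c p = c p'"
      using p(2)[of p'] by (auto simp: B_def)
    \<comment> \<open>Contiguity keeps other colours out of the gap, and minimality places the rest
      of the block to the right of \<open>p\<close>.\<close>
    have "{x \<in> A. p < x \<and> x < p'} = {x \<in> B - {p}. x < p'}"
    proof (intro equalityI subsetI)
      fix x assume "x \<in> {x \<in> A. p < x \<and> x < p'}"
      then show "x \<in> {x \<in> B - {p}. x < p'}"
        using contiguousD[OF A(2) p(1) _ p'(1), of x] p'(3) by (auto simp: B_def)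
    next
      fix x assume "x \<in> {x \<in> B - {p}. x < p'}"
      then show "x \<in> {x \<in> A. p < x \<and> x < p'}"
        using p(2)[of x] by (auto simp: B_def)
    qed
    then show "(\<Sum>\<sigma>\<in>?X p'. q ^ crossing_number \<sigma>)
        = q ^ card {x \<in> B - {p}. x < p'} * crossing_sum q (A - {p, p'}) c"
      using coloured_matchings_with_edge[OF A p(1) p' new] by simp
  qed
  finally show ?thesis .
qed

text \<open>An injective colouring excludes no edge, so both sums run over all complete matchings of
  \<open>A\<close>.\<close>

lemma crossing_sum_inj:
  assumes "inj_on c A" "inj_on d A"
  shows "crossing_sum q A c = crossing_sum q A d"
proof -
  have "e \<subseteq> A" if "complete_matching A \<sigma>" "e \<in> \<sigma>" for \<sigma> e
    using that by (auto simp: complete_matching_def partition_on_def)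
  then have "coloured_matchings A c = coloured_matchings A d"
    using assms by (auto simp: coloured_matchings_def intro: inj_on_subset)
  then show ?thesis by (simp add: crossing_sum_def)
qed

text \<open>A single colour excludes every edge, but a matching of a nonempty set has one.\<close>

lemma crossing_sum_const:
  assumes "A \<noteq> {}"
  shows "crossing_sum q A (\<lambda>_. k) = 0"
proof -
  have "\<sigma> \<notin> coloured_matchings A (\<lambda>_. k)" for \<sigma>
  proof
    assume \<sigma>: "\<sigma> \<in> coloured_matchings A (\<lambda>_. k)"
    then have m: "complete_matching A \<sigma>" by (simp add: coloured_matchings_def)
    with assms obtain e where e: "e \<in> \<sigma>"
      by (auto simp: complete_matching_def partition_on_def)
    obtain x y where "e = {x, y}" "x < y"
      using complete_matching_edgeE[OF m e] .
    with \<sigma> e show False by (auto simp: coloured_matchings_def)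
  qed
  then have "coloured_matchings A (\<lambda>_. k) = {}" by blast
  then show ?thesis by (simp add: crossing_sum_def)
qed

text \<open>Ranks in \<open>S\<close> run through 0, ..., \<open>card S - 1\<close>. For powers of
  \<open>q\<close> this yields the q-integer of \<open>qHermite_resc_mult\<close>.\<close>

lemma sum_card_less:
  fixes S :: "'a::linorder set"
  assumes "finite S"
  shows "(\<Sum>s\<in>S. f (card {x \<in> S. x < s})) = (\<Sum>j<card S. f j)"
  using assms
proof (induction S rule: finite_linorder_max_induct)
  case (insert b S)
  have b: "b \<notin> S" using insert.hyps by auto
  have "{x \<in> insert b S. x < s} = {x \<in> S. x < s}" if "s \<in> S" for s
    using insert.hyps that by auto
  moreover have "{x \<in> insert b S. x < b} = S" using insert.hyps by auto
  ultimately show ?case using insert b by (simp add: add.commute)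
qed simp

section \<open>The splitting recurrence for the integrals\<close>

definition block_size :: "nat set \<Rightarrow> (nat \<Rightarrow> nat) \<Rightarrow> nat \<Rightarrow> nat" where
  "block_size A c k = card {x \<in> A. c x = k}"

definition block_integral :: "real \<Rightarrow> nat set \<Rightarrow> (nat \<Rightarrow> nat) \<Rightarrow> real" where
  "block_integral q A c =
     qHermite_functional q (\<lambda>x. \<Prod>k\<in>c ` A. qHermite_resc q (block_size A c k) x)"

context
  fixes q :: real
  assumes q: "0 < q" "q < 1"
begin

text \<open>A colour that does not occur contributes the polynomial of degree 0, which is 1. Hence
  different colourings can be compared over one common index set.\<close>

lemma block_integral_superset:
  assumes "c ` A \<subseteq> K" "finite K"
  shows "block_integral q A c
           = qHermite_functional q (\<lambda>x. \<Prod>k\<in>K. qHermite_resc q (block_size A c k) x)"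
proof -
  have "block_size A c k = 0" if "k \<notin> c ` A" for k
  proof -
    have "{x \<in> A. c x = k} = {}" using that by auto
    then show ?thesis by (simp only: block_size_def card.empty)
  qed
  then have "(\<Prod>k\<in>K. qHermite_resc q (block_size A c k) x)
      = (\<Prod>k\<in>c ` A. qHermite_resc q (block_size A c k) x)" for x
    using assms by (intro prod.mono_neutral_right) (auto simp: qHermite_resc_0[OF q])
  then show ?thesis by (simp add: block_integral_def)
qed

lemma block_integral_inj:
  assumes "inj_on c A"
  shows "block_integral q A c = qHermite_functional q (\<lambda>x. x ^ card A)"
proof -
  have "block_size A c k = Suc 0" if k: "k \<in> c ` A" for k
  proof -
    obtain a where "a \<in> A" "k = c a" using k by auto
    then have "{x \<in> A. c x = k} = {a}" using assms by (auto simp: inj_on_def)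
    then show ?thesis by (simp add: block_size_def)
  qed
  then have "(\<Prod>k\<in>c ` A. qHermite_resc q (block_size A c k) x) = x ^ card A" for x
    using assms by (simp add: qHermite_resc_1[OF q] card_image)
  then show ?thesis by (simp add: block_integral_def)
qed

text \<open>The analytic counterpart of \<open>crossing_sum_split\<close>: recolouring
  \<open>p\<close> replaces the factor of degree \<open>b + 2\<close> by those of degrees 1 and
  \<open>b + 1\<close>, and \<open>qHermite_resc_mult\<close> expands their product. The point
  \<open>x0\<close> ensures that the block has at least two elements.\<close>

lemma block_integral_split:
  assumes A: "finite A" and p: "p \<in> A" "x0 \<in> A" "x0 \<noteq> p" "c x0 = c p" and new: "new \<notin> c ` A"
  defines "B \<equiv> {x \<in> A. c x = c p}"
  shows "block_integral q A (c(p := new)) = block_integral q A c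
           + (\<Sum>p'\<in>B - {p}. q ^ card {x \<in> B - {p}. x < p'} * block_integral q (A - {p, p'}) c)"
proof -
  let ?c = "c(p := new)" and ?K = "c ` A" and ?h = "qHermite_resc q"
  have B: "finite B" "p \<in> B" "x0 \<in> B"
    using A p by (auto simp: B_def)
  then have "card (B - {p} - {x0}) = card B - 2" "card B \<ge> 2"
    using p(3) card_mono[of B "{p, x0}"] by auto
  then obtain b where b: "card B = Suc (Suc b)"
    by (metis add_2_eq_Suc le_Suc_ex)
  have cB: "card (B - {p}) = Suc b" using B b by simp
  define R where "R x = (\<Prod>k\<in>?K - {c p}. ?h (block_size A c k) x)" for x
  have cont: "continuous_on UNIV (\<lambda>x. ?h m x * R x)" for m
    unfolding R_def by (intro continuous_intros continuous_on_qHermite_resc[OF q])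
  \<comment> \<open>The factor \<open>R\<close> of the other colours is common to all integrals;
    only the size of the block of \<open>c p\<close> varies.\<close>
  have functional: "qHermite_functional q (\<lambda>x. \<Prod>k\<in>?K. ?h (block_size A' d k) x)
      = qHermite_functional q (\<lambda>x. ?h (block_size A' d (c p)) x * R x)"
    if "\<And>k. k \<in> ?K - {c p} \<Longrightarrow> block_size A' d k = block_size A c k" for A' d
    unfolding R_def using A p that by (simp add: prod.remove[of ?K "c p"])
  have I: "block_integral q A c = qHermite_functional q (\<lambda>x. ?h (Suc (Suc b)) x * R x)"
  proof -
    have "block_size A c (c p) = Suc (Suc b)" using b by (simp add: block_size_def B_def)
    then show ?thesis using functional[of A c] by (simp add: block_integral_def)
  qed
  have I': "block_integral q (A - {p, p'}) c = qHermite_functional q (\<lambda>x. ?h b x * R x)"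
    if "p' \<in> B - {p}" for p'
  proof -
    have p': "c p' = c p" "p' \<in> B" "p' \<noteq> p" using that by (auto simp: B_def)
    have same: "block_size (A - {p, p'}) c k = block_size A c k" if "k \<in> ?K - {c p}" for k
      unfolding block_size_def by (rule arg_cong[where f = card]) (use that p' in auto)
    have "{x \<in> A - {p, p'}. c x = c p} = B - {p} - {p'}" by (auto simp: B_def)
    then have "block_size (A - {p, p'}) c (c p) = b"
      using cB p' B by (simp add: block_size_def)
    then show ?thesis
      using functional[OF same] A by (subst block_integral_superset[of _ _ ?K]) auto
  qed
  have "block_integral q A ?c
      = qHermite_functional q (\<lambda>x. ?h (Suc 0) x * (?h (Suc b) x * R x))"
  proof -
    have "{x \<in> A. ?c x = new} = {p}" using new p by auto
    then have new1: "block_size A ?c new = Suc 0" by (simp add: block_size_def)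
    have cp: "c p \<noteq> new" using new p by auto
    have "{x \<in> A. ?c x = c p} = B - {p}" using cp by (auto simp: B_def)
    then have sz: "block_size A ?c (c p) = Suc b" using cB by (simp add: block_size_def)
    have same: "block_size A ?c k = block_size A c k" if "k \<in> ?K - {c p}" for k
      unfolding block_size_def by (rule arg_cong[where f = card]) (use that new in auto)
    have "(\<Prod>k\<in>insert new ?K. ?h (block_size A ?c k) x) = ?h (Suc 0) x * (?h (Suc b) x * R x)" for x
      unfolding R_def using A p new new1 sz same by (simp add: prod.remove[of ?K "c p"])
    moreover have "?c ` A \<subseteq> insert new ?K" by auto
    ultimately show ?thesis
      using A by (subst block_integral_superset[of _ _ "insert new ?K"]) auto
  qed
  also have "(\<lambda>x. ?h (Suc 0) x * (?h (Suc b) x * R x))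
      = (\<lambda>x. ?h (Suc (Suc b)) x * R x + (\<Sum>j<Suc b. q ^ j) * (?h b x * R x))"
    unfolding mult.assoc[symmetric] qHermite_resc_mult[OF q] by (simp only: distrib_right)
  also have "qHermite_functional q \<dots>
      = block_integral q A c + (\<Sum>j<Suc b. q ^ j) * qHermite_functional q (\<lambda>x. ?h b x * R x)"
    unfolding I
    by (subst qHermite_functional_add[OF q]) (auto intro!: cont continuous_on_mult_left simp: qHermite_functional_cmult)
  also have "(\<Sum>j<Suc b. q ^ j) * qHermite_functional q (\<lambda>x. ?h b x * R x)
      = (\<Sum>p'\<in>B - {p}. q ^ card {x \<in> B - {p}. x < p'} * qHermite_functional q (\<lambda>x. ?h b x * R x))"
    using sum_card_less[of "B - {p}" "\<lambda>j. q ^ j"] B(1)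
    by (simp only: cB sum_distrib_right[symmetric] finite_Diff)
  also have "\<dots> = (\<Sum>p'\<in>B - {p}. q ^ card {x \<in> B - {p}. x < p'} * block_integral q (A - {p, p'}) c)"
    by (intro sum.cong refl) (simp only: I')
  finally show ?thesis .
qed

lemma block_integral_const:
  assumes "finite A" "A \<noteq> {}"
  shows "block_integral q A (\<lambda>_. k) = 0"
proof -
  have "(\<lambda>_. k) ` A = {k}" "block_size A (\<lambda>_. k) k = card A" "card A \<noteq> 0"
    using assms by (auto simp: block_size_def)
  then show ?thesis
    by (simp add: block_integral_def qHermite_functional_resc[OF q])
qed

text \<open>The outer induction on \<open>card A\<close> makes the correction terms of the two
  splitting lemmas agree. The inner one shows that the remaining difference \<open>?D\<close> does
  not depend on the colouring, with \<open>id\<close> as reference.\<close>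

lemma block_integral_eq_crossing_sum:
  assumes "finite A" "contiguous A c"
  shows "block_integral q A c = crossing_sum q A c"
  using assms
proof (induction "card A" arbitrary: A c rule: less_induct)
  case less
  note IH = less.hyps and finA = \<open>finite A\<close>
  show ?case
  proof (cases "A = {}")
    case True
    have "coloured_matchings {} c = {{}}"
      by (auto simp: coloured_matchings_def complete_matching_def partition_on_def)
    then have "crossing_sum q {} c = 1"
      by (simp add: crossing_sum_def crossing_number_def)
    moreover have "block_integral q {} c = 1"
      using qHermite_functional_resc[OF q, of 0]
      by (simp add: block_integral_def qHermite_resc_0[OF q, abs_def] cong: if_cong)
    ultimately show ?thesis using True by simp
  next
    case False
    let ?D = "\<lambda>c. block_integral q A c - crossing_sum q A c"
    have D: "?D c = ?D id" if "contiguous A c" for c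
      using that
    \<comment> \<open>The measure is the number of colours missing for injectivity, which each split
      lowers.\<close>
    proof (induction "card A - card (c ` A)" arbitrary: c rule: less_induct)
      case (less c)
      show ?case
      proof (cases "inj_on c A")
        case True
        then show ?thesis
          using block_integral_inj[OF True] block_integral_inj[of id A] crossing_sum_inj[of c A id]
          by simp
      next
        case not_inj: False
        then obtain x y where xy: "x \<in> A" "y \<in> A" "x \<noteq> y" "c x = c y"
          by (auto simp: inj_on_def)
        define B where "B = {z \<in> A. c z = c x}"
        define p where "p = Min B"
        have B: "finite B" "B \<noteq> {}"
          using finA xy by (auto simp: B_def)
        have pB: "p \<in> B" unfolding p_def using B by (rule Min_in)
        then have p: "p \<in> A" "c p = c x" by (auto simp: B_def)
        have p_le: "p \<le> z" if "z \<in> A" "c z = c p" for z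
          unfolding p_def using that B p by (intro Min_le) (auto simp: B_def)
        obtain x0 where x0: "x0 \<in> A" "x0 \<noteq> p" "c x0 = c p"
          using xy p by metis
        obtain new where new: "new \<notin> c ` A"
          using ex_new_if_finite[of "c ` A"] finA by auto
        let ?c = "c(p := new)"
        have "contiguous A ?c"
          unfolding contiguous_def
        proof (intro ballI impI)
          fix u v w assume uvw: "u \<in> A" "v \<in> A" "w \<in> A" "u < v" "v < w" "?c u = ?c w"
          \<comment> \<open>The new colour occurs only at \<open>p\<close>, so \<open>u\<close> and
            \<open>w\<close> keep their old colour. The middle point is not \<open>p\<close> either,
            because \<open>p\<close> is the left end of its block.\<close>
          then have ne: "u \<noteq> p" "w \<noteq> p" using new by (auto split: if_splits)
          then have "c v = c u" using contiguousD[OF less.prems, of u v w] uvw by simp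
          moreover have "v \<noteq> p" using p_le[of u] uvw calculation by auto
          ultimately show "?c v = ?c u" using ne by simp
        qed
        moreover have "card A - card (?c ` A) < card A - card (c ` A)"
        proof -
          \<comment> \<open>The old colour of \<open>p\<close> is not lost, since \<open>x0\<close>
            still carries it.\<close>
          have "c ` A \<subseteq> ?c ` A"
          proof
            fix k assume "k \<in> c ` A"
            then obtain z where z: "z \<in> A" "k = c z" by auto
            show "k \<in> ?c ` A"
            proof (cases "z = p")
              case True
              then have "k = ?c x0" using z x0 by simp
              then show ?thesis using x0(1) by blast
            next
              case False
              then have "k = ?c z" using z by simp
              then show ?thesis using z(1) by blast
            qed
          qed
          moreover have "new \<in> ?c ` A" using p(1) by force
          ultimately have "c ` A \<subset> ?c ` A" using new by blast
          then have "card (c ` A) < card (?c ` A)"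
            using finA by (intro psubset_card_mono) auto
          moreover have "card (?c ` A) \<le> card A"
            using finA by (rule card_image_le)
          ultimately show ?thesis by linarith
        qed
        ultimately have "?D ?c = ?D id" using less.hyps by blast
        moreover have "?D ?c = ?D c"
        proof -
          have "block_integral q (A - {p, p'}) c = crossing_sum q (A - {p, p'}) c" for p'
            using finA p(1) less.prems
            by (intro IH[OF _ _ contiguous_subset]) (auto intro!: psubset_card_mono)
          then show ?thesis
            using block_integral_split[OF finA p(1) x0 new]
              crossing_sum_split[OF finA less.prems p(1) p_le new, of q] by simp
        qed
        ultimately show ?thesis by simp
      qed
    qed
    \<comment> \<open>A single block makes both sides vanish, which determines the common value of
      \<open>?D\<close>.\<close>
    have "contiguous A (\<lambda>_. 0)" by (simp add: contiguous_def)
    then have "?D c = ?D (\<lambda>_. 0)"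
      using D less.prems(2) by simp
    also have "\<dots> = 0"
      using False less.prems(1) by (simp add: block_integral_const crossing_sum_const)
    finally show ?thesis by simp
  qed
qed

end

section \<open>The given segments as colour classes\<close>

text \<open>The colours 1 to 4 mark the segments \<open>S\<^sub>1\<close> to
  \<open>S\<^sub>4\<close>. The shift by 4 keeps the colours of \<open>S\<^sub>0\<close> distinct
  from these and from each other, so its points are blocks of size 1.\<close>

lemma coloured_matchings_CM:
  fixes n n1 n2 n3 n4 :: nat
  defines "c \<equiv> \<lambda>x. if x \<le> n then x + 4 else if x \<le> n + n1 then 1
             else if x \<le> n + n1 + n2 then 2 else if x \<le> n + n1 + n2 + n3 then 3 else 4"
    and "A \<equiv> {1..n + n1 + n2 + n3 + n4}"
  shows "CM n [n1, n2, n3, n4] = coloured_matchings A c"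
    and "contiguous A c"
    and "0 < q \<Longrightarrow> q < 1 \<Longrightarrow> block_integral q A c = f_resc n n1 n2 n3 n4 q"
proof -
  have idx: "{0..length [n1, n2, n3, n4]} = {0, 1, 2, 3, 4}" "{1..length [n1, n2, n3, n4]} = {1, 2, 3, 4}"
    by auto
  have seg: "segment n [n1, n2, n3, n4] 0 = {1..n}"
    "segment n [n1, n2, n3, n4] 1 = {n + 1..n + n1}"
    "segment n [n1, n2, n3, n4] 2 = {n + n1 + 1..n + n1 + n2}"
    "segment n [n1, n2, n3, n4] 3 = {n + n1 + n2 + 1..n + n1 + n2 + n3}"
    "segment n [n1, n2, n3, n4] 4 = {n + n1 + n2 + n3 + 1..n + n1 + n2 + n3 + n4}"
    by (simp_all add: segment_def seg_end_def numeral_eq_Suc)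
  have union: "(\<Union>i\<in>{0, 1, 2, 3, 4}. segment n [n1, n2, n3, n4] i) = A"
    by (auto simp: seg[unfolded One_nat_def] A_def)
  have edge: "(\<forall>i\<in>{1, 2, 3, 4}. \<not> e \<subseteq> segment n [n1, n2, n3, n4] i) \<longleftrightarrow> inj_on c e"
    if m: "complete_matching A \<sigma>" "e \<in> \<sigma>" for e \<sigma>
  proof -
    obtain x y where "e = {x, y}" "x < y" "x \<in> A" "y \<in> A"
      using complete_matching_edgeE[OF m] .
    then show ?thesis
      by (auto simp: seg[unfolded One_nat_def] A_def c_def)
  qed
  show "CM n [n1, n2, n3, n4] = coloured_matchings A c"
    unfolding CM_def coloured_matchings_def idx union using edge by blast
  show "contiguous A c"
    unfolding contiguous_def c_def A_def by auto
  show "block_integral q A c = f_resc n n1 n2 n3 n4 q" if q: "0 < q" "q < 1"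
  proof -
    have "{x \<in> A. c x = 1} = {n + 1..n + n1}"
      "{x \<in> A. c x = 2} = {n + n1 + 1..n + n1 + n2}"
      "{x \<in> A. c x = 3} = {n + n1 + n2 + 1..n + n1 + n2 + n3}"
      "{x \<in> A. c x = 4} = {n + n1 + n2 + n3 + 1..n + n1 + n2 + n3 + n4}"
      by (auto simp: A_def c_def split: if_splits)
    then have big: "block_size A c 1 = n1" "block_size A c 2 = n2"
      "block_size A c 3 = n3" "block_size A c 4 = n4"
      by (simp_all add: block_size_def)
    have "{x \<in> A. c x = k} = {k - 4}" if "k \<in> {5..n + 4}" for k
      using that by (auto simp: A_def c_def split: if_splits)
    then have small: "block_size A c k = Suc 0" if "k \<in> {5..n + 4}" for k
      using that by (simp add: block_size_def)
    \<comment> \<open>Only an inclusion holds, because a segment with \<open>n\<^sub>i = 0\<close>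
      leaves its colour out. The colours from 5 on contribute one factor \<open>x\<close> each,
      hence \<open>x ^ n\<close>.\<close>
    have "c ` A \<subseteq> {1, 2, 3, 4} \<union> {5..n + 4}"
      by (auto simp: A_def c_def)
    then have I: "block_integral q A c = qHermite_functional q
        (\<lambda>x. \<Prod>k\<in>{1, 2, 3, 4} \<union> {5..n + 4}. qHermite_resc q (block_size A c k) x)"
      by (intro block_integral_superset[OF q]) auto
    have "(\<Prod>k\<in>{1, 2, 3, 4} \<union> {5..n + 4}. qHermite_resc q (block_size A c k) x)
        = x ^ n * qHermite_resc q n1 x * qHermite_resc q n2 x * qHermite_resc q n3 x * qHermite_resc q n4 x" for x
    proof -
      have "(\<Prod>k\<in>{1, 2, 3, 4} \<union> {5..n + 4}. qHermite_resc q (block_size A c k) x)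
          = (\<Prod>k\<in>{1, 2, 3, 4}. qHermite_resc q (block_size A c k) x)
            * (\<Prod>k\<in>{5..n + 4}. qHermite_resc q (block_size A c k) x)"
        by (intro prod.union_disjoint) auto
      moreover have "(\<Prod>k\<in>{5..n + 4}. qHermite_resc q (block_size A c k) x) = (\<Prod>k\<in>{5..n + 4}. x)"
        by (intro prod.cong refl) (simp only: small qHermite_resc_1[OF q])
      ultimately show ?thesis using big by (simp add: mult_ac)
    qed
    then show ?thesis
      unfolding I by (simp add: f_resc_def qHermite_functional_def weight_support_def)
  qed
qed

theorem theorem5p1:
  fixes q :: real and n n1 n2 n3 n4 :: nat
  assumes "0 < q" and "q < 1"
  shows "f_resc n n1 n2 n3 n4 q = (\<Sum>\<sigma>\<in>CM n [n1, n2, n3, n4]. q ^ crossing_number \<sigma>)"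
  unfolding coloured_matchings_CM(1) coloured_matchings_CM(3)[OF assms, symmetric]
    crossing_sum_def[symmetric]
  by (intro block_integral_eq_crossing_sum assms coloured_matchings_CM(2)) simp

end
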